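(* Let $d,a,b,c_1,\dots,c_n$ be positive integers with $d\mid q-1$, let $\lambda_1,\dots,\lambda_n\in\kappa^\times$, and let $S_{C,\lambda}$ be the $n$-dimensional affine hypersurface over $\kappa$ defined by $$y^d=\Big(\prod_{i=1}^nx_i^{c_i}\Big)\Big(1-\sum_{i=1}^nx_i\Big)^a\Big(\prod_{i=1}^nx_i-\sum_{i=1}^n\lambda_i\prod_{j\neq i}x_j\Big)^b,$$ with $\mu_d$ acting by $\xi\cdot(x_1,\dots,x_n,y)=(x_1,\dots,x_n,\xi y)$. Suppose that $\gcd(d,a)=\gcd(d,b)=1$. Then, for $m\in\mathbb{Z}/d\mathbb{Z}$, $$N_1(S_{C,\lambda};\chi^m)=\begin{cases}q^n&(m=0),\\ (-1)^nJ_C\cdot F_C^{(n)}\left({\overline{\varphi_d}^{m(a+nb+\sum_{i=1}^nc_i)};\overline{\varphi_d}^{mb}\atop\overline{\varphi_d}^{m(b+c_1)},\dots,\overline{\varphi_d}^{m(b+c_n)}};\lambda_1,\dots,\lambda_n\right)&(m\neq0),\end{cases}$$ where $J_C=j(\varphi_d^{ma},\varphi_d^{m(b+c_1)},\dots,\varphi_d^{m(b+c_n)})$.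
   Context: $\kappa$ is a finite field with $q$ elements of characteristic $p$. $\widehat{\kappa^\times}=\mathrm{Hom}(\kappa^\times,\overline{\mathbb{Q}}^\times)$ is the group of multiplicative characters, $\varepsilon$ the trivial character, $\overline{\eta}=\eta^{-1}$; every $\eta\in\widehat{\kappa^\times}$ (including $\varepsilon$) is extended to $\kappa$ by $\eta(0)=0$. $\delta(\eta)=1$ if $\eta=\varepsilon$ and $0$ otherwise. Fix a non-trivial additive character $\psi\in\mathrm{Hom}(\kappa,\overline{\mathbb{Q}}^\times)$. Put $$g(\eta)=-\sum_{x\in\kappa^\times}\psi(x)\eta(x),\quad g^\circ(\eta)=q^{\delta(\eta)}g(\eta),\quad j(\eta_1,\dots,\eta_k)=(-1)^{k-1}\sum_{x_i\in\kappa^\times,\ x_1+\cdots+x_k=1}\ \prod_{i=1}^k\eta_i(x_i)\ (k\ge 2),$$ $$(\alpha)_\nu=\frac{g(\alpha\nu)}{g(\alpha)},\qquad(\alpha)_\nu^\circ=\frac{g^\circ(\alpha\nu)}{g^\circ(\alpha)},$$ $$F_C^{(n)}\left({\alpha;\beta\atop\gamma_1,\dots,\gamma_n};\lambda_1,\dots,\lambda_n\right)=\frac{1}{(1-q)^n}\sum_{\nu_1,\dots,\nu_n\in\widehat{\kappa^\times}}\frac{(\alpha)_{\nu_1\cdots\nu_n}(\beta)_{\nu_1\cdots\nu_n}}{(\gamma_1)^\circ_{\nu_1}\cdots(\gamma_n)^\circ_{\nu_n}(\varepsilon)^\circ_{\nu_1}\cdots(\varepsilon)^\circ_{\nu_n}}\nu_1(\lambda_1)\cdots\nu_n(\lambda_n).$$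 $\mu_d\subset\kappa^\times$ is the group of $d$th roots of unity. Fix a generator $\varphi$ of $\widehat{\kappa^\times}$ and put $\varphi_d=\varphi^{(q-1)/d}$, $\chi=\varphi|_{\mu_d}$, so that $\widehat{\mu_d}=\{\chi^m\mid m\in\mathbb{Z}/d\mathbb{Z}\}$. For a variety $V$ over $\kappa$ with an action over $\kappa$ of a finite abelian group $G$, with $F$ the $q$-Frobenius on $V(\overline{\kappa})$, and for $\theta\in\mathrm{Hom}(G,\overline{\mathbb{Q}}^\times)$ and $r\ge1$, $$N_r(V;\theta)=\frac{1}{\#G}\sum_{g\in G}\theta(g)\,\#\{x\in V(\overline{\kappa})\mid F^r(x)=g(x)\}.$$ *)

theory Defs
  imports "HOL-Algebra.Algebraic_Closure_Type" "HOL-Algebra.Elementary_Groups"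
    "HOL-Library.Cardinality"
begin

text \<open>
  Throughout, the finite field $\kappa$ is a type \<open>'k :: {finite, field}\<close> with
  $q = $ \<open>CARD('k)\<close>, its algebraic closure is \<open>'k alg_closure\<close> (with embedding \<open>to_ac\<close>),
  and index sets such as $\{1, \ldots, n\}$ are finite types \<open>'n\<close> with $n = $ \<open>CARD('n)\<close>.
\<close>

type_synonym qbar = "rat alg_closure"


subsection \<open>Characters of a finite field\<close>

definition add_character :: "('k :: {finite, field} \<Rightarrow> qbar) \<Rightarrow> bool" where
  "add_character \<psi> \<longleftrightarrow>
     (\<forall>x. \<psi> x \<noteq> 0) \<and> (\<forall>x y. \<psi> (x + y) = \<psi> x * \<psi> y)"

definition trivial_char :: "'k :: {finite, field} \<Rightarrow> qbar" where
  "trivial_char = (\<lambda>x. if x = 0 then 0 else 1)"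

text \<open>
  The group of homomorphisms from the units of the field to the units of \<open>qbar\<close>; its elements
  are functions on the whole field, every character (the trivial one included) being
  extended by the value \<open>0\<close> at \<open>0\<close>.
\<close>

definition char_group :: "('k :: {finite, field} \<Rightarrow> qbar) monoid" where
  "char_group =
     \<lparr>carrier = {\<eta>. \<eta> 0 = 0 \<and> (\<forall>x. x \<noteq> 0 \<longrightarrow> \<eta> x \<noteq> 0) \<and>
                    (\<forall>x y. x \<noteq> 0 \<longrightarrow> y \<noteq> 0 \<longrightarrow> \<eta> (x * y) = \<eta> x * \<eta> y)},
      monoid.mult = (\<lambda>\<eta> \<nu> x. \<eta> x * \<nu> x),
      one = trivial_char\<rparr>"

lemma comm_group_char_group: "comm_group (char_group :: ('k :: {finite, field} \<Rightarrow> qbar) monoid)"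
proof (rule comm_groupI)
  fix \<eta> :: "'k \<Rightarrow> qbar" assume \<eta>: "\<eta> \<in> carrier char_group"
  have "(\<lambda>x. inverse (\<eta> x)) \<in> carrier char_group"
    using \<eta> by (auto simp: char_group_def)
  moreover have "(\<lambda>x. inverse (\<eta> x)) \<otimes>\<^bsub>char_group\<^esub> \<eta> = \<one>\<^bsub>char_group\<^esub>"
    using \<eta> by (auto simp: char_group_def trivial_char_def fun_eq_iff)
  ultimately show "\<exists>\<nu>\<in>carrier char_group. \<nu> \<otimes>\<^bsub>char_group\<^esub> \<eta> = \<one>\<^bsub>char_group\<^esub>"
    by blast
qed (auto simp: char_group_def trivial_char_def fun_eq_iff mult.assoc mult.commute mult.left_commute)

lemma finite_char_group: "finite (carrier (char_group :: ('k :: {finite, field} \<Rightarrow> qbar) monoid))"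
proof -
  define N where "N = card (UNIV - {0 :: 'k})"
  have "(1 :: 'k) \<in> UNIV - {0}" by simp
  then have Npos: "N > 0"
    unfolding N_def by (intro card_gt_0_iff[THEN iffD2] conjI) (blast, rule finite)
  define B where "B = insert 0 {z :: qbar. z ^ N = 1}"
  have "finite {z :: qbar. z ^ N = 1}"
  proof (rule finite_subset)
    show "{z :: qbar. z ^ N = 1} \<subseteq> {z. poly (Polynomial.monom 1 N - 1) z = 0}"
      by (auto simp: poly_monom)
    have "Polynomial.coeff (Polynomial.monom 1 N - 1 :: qbar poly) N = 1"
      using Npos by (simp add: coeff_1)
    then have "Polynomial.monom 1 N - 1 \<noteq> (0 :: qbar poly)"
      by (metis coeff_0 zero_neq_one)
    then show "finite {z :: qbar. poly (Polynomial.monom 1 N - 1) z = 0}"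
      by (rule poly_roots_finite)
  qed
  then have finB: "finite B" by (simp add: B_def)
  have "\<eta> x \<in> B" if \<eta>: "\<eta> \<in> carrier char_group" for \<eta> and x :: 'k
  proof (cases "x = 0")
    case True
    then show ?thesis using \<eta> by (simp add: char_group_def B_def)
  next
    case False
    have nz: "(\<Prod>y\<in>UNIV - {0}. \<eta> y) \<noteq> 0"
      using \<eta> by (simp add: char_group_def)
    have "bij_betw (\<lambda>y. x * y) (UNIV - {0}) (UNIV - {0})"
      by (rule bij_betw_byWitness[where f' = "\<lambda>y. y / x"]) (use False in auto)
    then have "(\<Prod>y\<in>UNIV - {0}. \<eta> y) = (\<Prod>y\<in>UNIV - {0}. \<eta> (x * y))"
      by (rule prod.reindex_bij_betw[symmetric])
    also have "\<dots> = (\<Prod>y\<in>UNIV - {0}. \<eta> x * \<eta> y)"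
      by (rule prod.cong) (use \<eta> False in \<open>auto simp: char_group_def\<close>)
    also have "\<dots> = \<eta> x ^ N * (\<Prod>y\<in>UNIV - {0}. \<eta> y)"
      by (simp add: prod.distrib N_def)
    finally show ?thesis using nz by (simp add: B_def)
  qed
  then have "carrier char_group \<subseteq> {\<eta> :: 'k \<Rightarrow> qbar. \<forall>x. (x \<in> UNIV \<longrightarrow> \<eta> x \<in> B) \<and> (x \<notin> UNIV \<longrightarrow> \<eta> x = 0)}"
    by auto
  moreover have "finite \<dots>"
    by (rule finite_set_of_finite_funs) (use finB in auto)
  ultimately show ?thesis by (rule finite_subset)
qed


subsection \<open>Gauss sums, Jacobi sums and the hypergeometric function\<close>

definition gauss_sum :: "('k :: {finite, field} \<Rightarrow> qbar) \<Rightarrow> ('k \<Rightarrow> qbar) \<Rightarrow> qbar" where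
  "gauss_sum \<psi> \<eta> = - (\<Sum>x\<in>UNIV - {0}. \<psi> x * \<eta> x)"

definition gauss_sum0 :: "('k :: {finite, field} \<Rightarrow> qbar) \<Rightarrow> ('k \<Rightarrow> qbar) \<Rightarrow> qbar" where
  "gauss_sum0 \<psi> \<eta> =
     of_nat CARD('k) ^ (if \<eta> = trivial_char then 1 else 0) * gauss_sum \<psi> \<eta>"

text \<open>The tuple $(\eta_1, \ldots, \eta_k)$ is a family over an index type with $k$ elements.\<close>

definition jacobi_sum :: "('i :: finite \<Rightarrow> 'k :: {finite, field} \<Rightarrow> qbar) \<Rightarrow> qbar" where
  "jacobi_sum \<eta> =
     (- 1) ^ (CARD('i) - 1) *
     (\<Sum>x | (\<forall>i. x i \<noteq> 0) \<and> (\<Sum>i\<in>UNIV. x i) = 1. \<Prod>i\<in>UNIV. \<eta> i (x i))"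

definition poch ::
    "('k :: {finite, field} \<Rightarrow> qbar) \<Rightarrow> ('k \<Rightarrow> qbar) \<Rightarrow> ('k \<Rightarrow> qbar) \<Rightarrow> qbar" where
  "poch \<psi> \<alpha> \<nu> = gauss_sum \<psi> (\<alpha> \<otimes>\<^bsub>char_group\<^esub> \<nu>) / gauss_sum \<psi> \<alpha>"

definition poch0 ::
    "('k :: {finite, field} \<Rightarrow> qbar) \<Rightarrow> ('k \<Rightarrow> qbar) \<Rightarrow> ('k \<Rightarrow> qbar) \<Rightarrow> qbar" where
  "poch0 \<psi> \<alpha> \<nu> = gauss_sum0 \<psi> (\<alpha> \<otimes>\<^bsub>char_group\<^esub> \<nu>) / gauss_sum0 \<psi> \<alpha>"

definition lauricella_C ::
    "('k :: {finite, field} \<Rightarrow> qbar) \<Rightarrow> ('k \<Rightarrow> qbar) \<Rightarrow> ('k \<Rightarrow> qbar) \<Rightarrow>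
     ('n :: finite \<Rightarrow> 'k \<Rightarrow> qbar) \<Rightarrow> ('n \<Rightarrow> 'k) \<Rightarrow> qbar" where
  "lauricella_C \<psi> \<alpha> \<beta> \<gamma> lam =
     1 / (1 - of_nat CARD('k)) ^ CARD('n) *
     (\<Sum>\<nu> | \<forall>i. \<nu> i \<in> carrier char_group.
        poch \<psi> \<alpha> (\<Otimes>\<^bsub>char_group\<^esub>i\<in>UNIV. \<nu> i) *
        poch \<psi> \<beta> (\<Otimes>\<^bsub>char_group\<^esub>i\<in>UNIV. \<nu> i) /
        ((\<Prod>i\<in>UNIV. poch0 \<psi> (\<gamma> i) (\<nu> i)) * (\<Prod>i\<in>UNIV. poch0 \<psi> trivial_char (\<nu> i))) *
        (\<Prod>i\<in>UNIV. \<nu> i (lam i)))"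


subsection \<open>Counting points of a variety with group action\<close>

text \<open>
  The variety enters through its set \<open>V\<close> of geometric points with Frobenius \<open>F\<close>; the finite
  group is a set \<open>G\<close> acting on points by \<open>act\<close>.
\<close>

definition twisted_count ::
    "('p \<Rightarrow> 'p) \<Rightarrow> 'g set \<Rightarrow> ('g \<Rightarrow> 'p \<Rightarrow> 'p) \<Rightarrow> nat \<Rightarrow> 'p set \<Rightarrow> ('g \<Rightarrow> qbar) \<Rightarrow> qbar" where
  "twisted_count F G act r V \<theta> =
     1 / of_nat (card G) * (\<Sum>g\<in>G. \<theta> g * of_nat (card {P \<in> V. (F ^^ r) P = act g P}))"

definition unity_roots :: "nat \<Rightarrow> 'k :: {finite, field} set" where
  "unity_roots d = {\<xi>. \<xi> ^ d = 1}"

type_synonym ('n, 'k) point = "('n \<Rightarrow> 'k alg_closure) \<times> 'k alg_closure"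

definition frobenius :: "('n :: finite, 'k :: {finite, field}) point \<Rightarrow> ('n, 'k) point" where
  "frobenius = (\<lambda>(x, y). (\<lambda>i. x i ^ CARD('k), y ^ CARD('k)))"

definition scale_y :: "'k :: {finite, field} \<Rightarrow> ('n :: finite, 'k) point \<Rightarrow> ('n, 'k) point" where
  "scale_y \<xi> = (\<lambda>(x, y). (x, to_ac \<xi> * y))"

definition hypersurface_C ::
    "nat \<Rightarrow> nat \<Rightarrow> nat \<Rightarrow> ('n :: finite \<Rightarrow> nat) \<Rightarrow> ('n \<Rightarrow> 'k :: {finite, field}) \<Rightarrow> ('n, 'k) point set"
  where
  "hypersurface_C d a b c lam =
     {(x, y). y ^ d =
        (\<Prod>i\<in>UNIV. x i ^ c i) * (1 - (\<Sum>i\<in>UNIV. x i)) ^ a *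
        ((\<Prod>i\<in>UNIV. x i) - (\<Sum>i\<in>UNIV. to_ac (lam i) * (\<Prod>j\<in>UNIV - {i}. x j))) ^ b}"


subsection \<open>Powers of the fixed generator\<close>

definition phi_d :: "('k :: {finite, field} \<Rightarrow> qbar) \<Rightarrow> nat \<Rightarrow> 'k \<Rightarrow> qbar" where
  "phi_d \<phi> d = \<phi> [^]\<^bsub>char_group\<^esub> ((CARD('k) - 1) div d)"

text \<open>\<open>\<chi>\<^sup>m\<close> for the restriction \<open>\<chi>\<close> of \<open>\<phi>\<close> to the \<open>d\<close>-th roots of unity.\<close>

definition chi_pow :: "('k :: {finite, field} \<Rightarrow> qbar) \<Rightarrow> nat \<Rightarrow> int \<Rightarrow> 'k \<Rightarrow> qbar" where
  "chi_pow \<phi> d m = (\<lambda>\<xi>\<in>unity_roots d. \<phi> \<xi> powi m)"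

end

theory Submission
  imports Defs
begin

text \<open>
  Why the formula holds. A point \<open>(x, y)\<close> counted with \<open>\<xi> \<in> \<mu>\<^sub>d\<close> has a rational \<open>x\<close>, because \<open>\<mu>\<^sub>d\<close> moves only
  \<open>y\<close>. If \<open>f x\<close> is the right-hand side of the equation and \<open>f x \<noteq> 0\<close>, each of the \<open>d\<close> roots \<open>y\<close> of \<open>y ^ d = f x\<close>
  satisfies \<open>y ^ q = f x ^ ((q - 1) / d) * y\<close>. Hence the twisted count is the sum of \<open>\<theta> (f x)\<close> over the
  rational points \<open>x\<close> with \<open>f x \<noteq> 0\<close>, where \<open>\<theta>\<close> is the \<open>m\<close>-th power of \<open>phi_d\<close>; the points with \<open>f x = 0\<close>
  contribute the mean of the character over \<open>\<mu>\<^sub>d\<close>, which is \<open>1\<close> or \<open>0\<close> (\<open>twisted_count_cyclic_cover\<close>). For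
  \<open>d\<close> dividing \<open>m\<close> every \<open>x\<close> counts once. Otherwise the factorisation of \<open>f\<close> on the torus turns the sum into
  one of
  \<open>(\<Prod>i. \<Gamma> i (x i)) * A (1 - (\<Sum>i. x i)) * B (1 - (\<Sum>i. lam i / x i))\<close>
  with \<open>A = \<theta>\<^sup>a\<close>, \<open>B = \<theta>\<^sup>b\<close> and \<open>\<Gamma> i\<close> the power of \<open>\<theta>\<close> with exponent \<open>b + c i\<close>.

  The identity for this sum (\<open>sum_eq_jacobi_sum_lauricella_C\<close>) holds for all characters with
  \<open>A\<close> and \<open>B\<close> nontrivial. The values of \<open>A\<close> and \<open>B\<close> are written as sums of additive characters with auxiliary
  variables \<open>t\<close> and \<open>s\<close>, divided by Gauss sums; the sum over \<open>x\<close> then factors into one twisted Kloosterman sum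
  for each coordinate. Expanding \<open>\<psi> (- s lam i / x i)\<close> in multiplicative characters \<open>\<nu> i\<close>, with Gauss
  sums as coefficients, evaluates each factor, and the remaining sums over \<open>s\<close> and \<open>t\<close> are Gauss sums too
  (\<open>sum_times_gauss_sums_expansion\<close>). On the other side, the reflection formula
  \<open>gauss_sum0_mult_gauss_sum_inverse\<close> moves the denominators of Lauricella's function into the numerator
  (\<open>lauricella_C_eq\<close>), and the formula for Jacobi sums in terms of Gauss sums (\<open>prod_gauss_sum\<close>) accounts
  for the constant in front.

  The expansion of \<open>\<psi>\<close> requires that there be enough characters with values in the algebraic
  closure of the rationals (\<open>characters_separate\<close>), which rests on the cyclicity of the group of units of a
  finite field and on the number of \<open>n\<close>-th roots in an algebraically closed field.
\<close>

section \<open>Roots in algebraically closed fields and finite fields\<close>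

text \<open>A multiple root would be a root of the derivative \<open>n X\<^sup>n\<^sup>-\<^sup>1\<close>, hence \<open>0\<close>, which is no root as \<open>c \<noteq> 0\<close>.\<close>

lemma card_nth_roots_alg_closed:
  fixes c :: "'a :: alg_closed_field"
  assumes "c \<noteq> 0" and n: "of_nat n \<noteq> (0 :: 'a)"
  shows "card {z. z ^ n = c} = n"
proof -
  have n0: "n > 0" using n by (cases n) auto
  define p where "p = Polynomial.monom 1 n - [:c:]"
  have poly_p: "poly p z = z ^ n - c" for z by (simp add: p_def poly_monom)
  have deg: "Polynomial.degree p = n"
    unfolding p_def using n0
    by (subst diff_conv_add_uminus, subst degree_add_eq_left) (auto simp: Polynomial.degree_monom_eq)
  have p0: "p \<noteq> 0" using deg n0 by auto
  obtain A where A: "size A = n" "p = Polynomial.smult (Polynomial.lead_coeff p) (\<Prod>x\<in>#A. [:-x, 1:])"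
    using alg_closed_imp_factorization[OF p0] deg by auto
  have lc: "Polynomial.lead_coeff p \<noteq> 0" using p0 by simp
  have poly_A: "poly p z = Polynomial.lead_coeff p * (\<Prod>x\<in>#A. z - x)" for z
    by (subst A(2)) (simp add: poly_prod_mset image_mset.compositionality o_def)
  have "z ^ n = c \<longleftrightarrow> z \<in># A" for z
  proof -
    have "z ^ n = c \<longleftrightarrow> poly p z = 0" by (simp add: poly_p)
    also have "\<dots> \<longleftrightarrow> z \<in># A"
      by (subst poly_A) (use lc in \<open>auto simp: prod_mset_zero_iff\<close>)
    finally show ?thesis .
  qed
  then have roots: "set_mset A = {z. z ^ n = c}" by auto
  have count_le: "count A z \<le> 1" for z
  proof (rule ccontr)
    assume "\<not> count A z \<le> 1"
    then have "{#z, z#} \<subseteq># A" by (auto simp: subseteq_mset_def)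
    then obtain B where "A = {#z, z#} + B" by (auto simp: mset_subset_eq_exists_conv)
    then have eq: "p = [:-z, 1:] * ([:-z, 1:] * Polynomial.smult (Polynomial.lead_coeff p) (\<Prod>x\<in>#B. [:-x, 1:]))"
      by (subst A(2)) (simp add: algebra_simps)
    have "poly (pderiv p) z = 0"
      by (subst eq, subst pderiv_mult, subst pderiv_mult) simp
    moreover have "poly (pderiv p) z = of_nat n * z ^ (n - 1)"
      by (simp add: p_def pderiv_diff pderiv_monom poly_monom)
    moreover have "z \<noteq> 0"
      using \<open>A = {#z, z#} + B\<close> roots n0 assms(1) by (auto simp: power_0_left)
    ultimately show False using n by simp
  qed
  have "count A z = count (mset_set (set_mset A)) z" for z
    using count_le[of z] by (cases "z \<in># A") (auto simp: le_Suc_eq count_eq_zero_iff)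
  then have "A = mset_set (set_mset A)" by (intro multiset_eqI)
  then have "card (set_mset A) = size A"
    by (metis size_mset_set)
  then show ?thesis using roots A(1) by simp
qed

lemma card_field_gt_1: "CARD('k :: {finite, field}) > 1"
proof -
  have "card {0, 1 :: 'k} \<le> CARD('k)" by (intro card_mono) auto
  then show ?thesis by simp
qed

lemma card_nonzero: "card (UNIV - {0 :: 'k :: {finite, field}}) = CARD('k) - 1"
  by (simp add: card_Diff_subset)

lemma of_nat_card_field: "of_nat CARD('k) = (0 :: 'k :: {finite, field})"
proof -
  have "(\<Sum>x\<in>UNIV. x :: 'k) = (\<Sum>x\<in>UNIV. x + 1)"
    by (rule sum.reindex_bij_witness[of _ "\<lambda>x. x + 1" "\<lambda>x. x - 1"]) auto
  then show ?thesis by (simp add: sum.distrib)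
qed

lemma power_card_minus_1:
  fixes x :: "'k :: {finite, field}"
  assumes "x \<noteq> 0"
  shows "x ^ (CARD('k) - 1) = 1"
proof -
  have "(\<Prod>y\<in>UNIV - {0}. y :: 'k) = (\<Prod>y\<in>UNIV - {0}. x * y)"
    by (rule prod.reindex_bij_witness[of _ "\<lambda>y. x * y" "\<lambda>y. y / x"]) (use assms in auto)
  also have "\<dots> = x ^ (CARD('k) - 1) * (\<Prod>y\<in>UNIV - {0}. y)"
    by (simp add: prod.distrib card_nonzero)
  finally show ?thesis by simp
qed

lemma power_card:
  fixes x :: "'k :: {finite, field}"
  shows "x ^ CARD('k) = x"
proof (cases "x = 0")
  case False
  have "x ^ CARD('k) = x ^ (CARD('k) - 1) * x"
    using card_field_gt_1[where 'k = 'k] by (metis power_minus_mult zero_less_one less_trans)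
  then show ?thesis using power_card_minus_1[OF False] by simp
qed (use card_field_gt_1[where 'k = 'k] in simp)

text \<open>
  The polynomial \<open>X\<^sup>q - X\<close> has at most \<open>q\<close> roots, and the \<open>q\<close> elements of the field
  already are such roots; so the points fixed by Frobenius are the rational ones.
\<close>

lemma frobenius_fixed_iff:
  fixes z :: "'k :: {finite, field} alg_closure"
  shows "z ^ CARD('k) = z \<longleftrightarrow> z \<in> range to_ac"
proof
  let ?q = "CARD('k)"
  let ?p = "Polynomial.monom 1 ?q - [:0, 1 :: 'k alg_closure:]"
  have q: "?q > 1" by (rule card_field_gt_1)
  have deg: "Polynomial.degree ?p = ?q"
    using q by (subst diff_conv_add_uminus, subst degree_add_eq_left) (auto simp: Polynomial.degree_monom_eq)
  then have p0: "?p \<noteq> 0" using q by auto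
  have roots: "{z. poly ?p z = 0} = {z. z ^ ?q = z}" by (auto simp: poly_monom)
  have fin: "finite {z :: 'k alg_closure. z ^ ?q = z}"
    using poly_roots_finite[OF p0] roots by simp
  have sub: "range to_ac \<subseteq> {z :: 'k alg_closure. z ^ ?q = z}"
    by (auto simp: power_card simp flip: to_ac_power)
  have "card {z :: 'k alg_closure. z ^ ?q = z} \<le> ?q"
    using card_poly_roots_bound[OF p0] roots deg by simp
  moreover have "card (range (to_ac :: 'k \<Rightarrow> _)) = ?q"
    by (simp add: card_image inj_to_ac)
  ultimately have "range to_ac = {z :: 'k alg_closure. z ^ ?q = z}"
    using card_seteq[OF fin sub] by simp
  then show "z ^ ?q = z \<Longrightarrow> z \<in> range to_ac" by blast
  show "z \<in> range to_ac \<Longrightarrow> z ^ ?q = z" using sub by blast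
qed

lemma of_nat_dvd_card_minus_1:
  assumes "d dvd CARD('k :: {finite, field}) - 1"
  shows "of_nat d \<noteq> (0 :: 'k)"
proof
  assume d: "of_nat d = (0 :: 'k)"
  obtain e where e: "CARD('k) - 1 = d * e" using assms by blast
  have "of_nat CARD('k) = (of_nat (d * e) + 1 :: 'k)"
    using card_field_gt_1[where 'k = 'k] e[symmetric] by (simp add: of_nat_diff)
  then show False using d of_nat_card_field[where 'k = 'k] by simp
qed

text \<open>
  The \<open>d\<close> roots of unity in the algebraic closure are fixed by Frobenius because \<open>d\<close> divides
  \<open>q - 1\<close>, so they all lie in the finite field.
\<close>

lemma card_unity_roots:
  assumes d: "d dvd CARD('k :: {finite, field}) - 1"
  shows "card (unity_roots d :: 'k set) = d"
proof -
  have "{z :: 'k alg_closure. z ^ d = 1} = to_ac ` unity_roots d"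
  proof (intro equalityI subsetI)
    fix z :: "'k alg_closure" assume z: "z \<in> {z. z ^ d = 1}"
    obtain e where e: "CARD('k) - 1 = d * e" using d by blast
    then have "CARD('k) = Suc (d * e)" using card_field_gt_1[where 'k = 'k] by simp
    then have "z ^ CARD('k) = z" using z by (simp add: power_mult)
    then obtain x where "z = to_ac x" using frobenius_fixed_iff by blast
    then show "z \<in> to_ac ` unity_roots d"
      using z by (auto simp: unity_roots_def simp flip: to_ac_power)
  qed (auto simp: unity_roots_def simp flip: to_ac_power)
  moreover have "card {z :: 'k alg_closure. z ^ d = 1} = d"
    using of_nat_dvd_card_minus_1[OF d]
    by (intro card_nth_roots_alg_closed) (simp_all flip: to_ac_of_nat)
  ultimately show ?thesis
    by (metis card_image inj_on_subset inj_to_ac subset_UNIV)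
qed

lemma cyclic_units:
  obtains g :: "'k :: {finite, field}"
  where "g \<noteq> 0" and "\<And>x. x \<noteq> 0 \<Longrightarrow> \<exists>i < CARD('k) - 1. x = g ^ i"
proof -
  interpret R: field "ring_of_type_algebra :: 'k ring" by (rule field_from_type_algebra)
  have car: "carrier (Multiplicative_Group.mult_of (ring_of_type_algebra :: 'k ring)) = UNIV - {0}"
    by (simp add: ring_of_type_algebra_def)
  have pow: "x [^]\<^bsub>ring_of_type_algebra :: 'k ring\<^esub> i = x ^ i" for x :: 'k and i :: nat
    by (induction i) (simp_all add: nat_pow_def ring_of_type_algebra_def mult_ac)
  have "\<exists>g \<in> UNIV - {0 :: 'k}. UNIV - {0} = {g ^ i | i. i \<in> (UNIV :: nat set)}"
    using R.finite_field_mult_group_has_gen[OF finite] unfolding car pow .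
  then obtain g :: 'k where g: "g \<noteq> 0" and gen: "UNIV - {0} = {g ^ i | i. i \<in> (UNIV :: nat set)}"
    by auto
  have "\<exists>i < CARD('k) - 1. x = g ^ i" if x: "x \<noteq> 0" for x
  proof -
    obtain i where i: "x = g ^ i" using gen x by blast
    have "g ^ i = g ^ ((CARD('k) - 1) * (i div (CARD('k) - 1)) + i mod (CARD('k) - 1))" by simp
    also have "\<dots> = g ^ (i mod (CARD('k) - 1))"
      by (simp only: power_add power_mult power_card_minus_1[OF g]) simp
    finally show ?thesis
      using i card_field_gt_1[where 'k = 'k] by (intro exI[of _ "i mod (CARD('k) - 1)"]) auto
  qed
  with g that show ?thesis by blast
qed

section \<open>Multiplicative characters\<close>

interpretation char_group: comm_group "char_group :: ('k :: {finite, field} \<Rightarrow> qbar) monoid"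
  by (rule comm_group_char_group)

lemma char_groupI:
  assumes "\<eta> 0 = 0" "\<And>x. x \<noteq> 0 \<Longrightarrow> \<eta> x \<noteq> 0"
    and "\<And>x y. x \<noteq> 0 \<Longrightarrow> y \<noteq> 0 \<Longrightarrow> \<eta> (x * y) = \<eta> x * \<eta> y"
  shows "\<eta> \<in> carrier char_group"
  using assms by (simp add: char_group_def)

lemma char_mult: "\<eta> \<in> carrier char_group \<Longrightarrow> \<eta> (x * y) = \<eta> x * \<eta> y"
  by (cases "x = 0 \<or> y = 0") (auto simp: char_group_def)

lemma char_eq_0_iff: "\<eta> \<in> carrier char_group \<Longrightarrow> \<eta> x = 0 \<longleftrightarrow> x = 0"
  by (auto simp: char_group_def)

lemma char_0: "\<eta> \<in> carrier char_group \<Longrightarrow> \<eta> 0 = 0"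
  by (simp add: char_group_def)

declare char_eq_0_iff [simp] char_0 [simp]

lemma char_1 [simp]: "\<eta> \<in> carrier char_group \<Longrightarrow> \<eta> 1 = 1"
  using char_mult[of \<eta> 1 1] by simp

lemma char_power: "\<eta> \<in> carrier char_group \<Longrightarrow> \<eta> (x ^ n) = \<eta> x ^ n"
  by (induction n) (simp_all add: char_mult)

lemma char_prod: "\<eta> \<in> carrier char_group \<Longrightarrow> \<eta> (\<Prod>i\<in>I. f i) = (\<Prod>i\<in>I. \<eta> (f i))"
  by (induction I rule: infinite_finite_induct) (simp_all add: char_mult)

lemma char_inverse: "\<eta> \<in> carrier char_group \<Longrightarrow> \<eta> (inverse x) = inverse (\<eta> x)"
proof (cases "x = 0")
  case False
  assume \<eta>: "\<eta> \<in> carrier char_group"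
  have "\<eta> (inverse x) * \<eta> x = 1"
    using \<eta> False by (simp flip: char_mult)
  then show ?thesis by (metis inverse_unique mult.commute)
qed simp

lemma char_minus_1_squared: "\<eta> \<in> carrier char_group \<Longrightarrow> \<eta> (- 1) * \<eta> (- 1) = 1"
  by (simp flip: char_mult)

lemma trivial_char_closed [simp]: "trivial_char \<in> carrier char_group"
  by (rule char_groupI) (auto simp: trivial_char_def)

lemma char_mult_closed [simp]:
  "\<eta> \<in> carrier char_group \<Longrightarrow> \<nu> \<in> carrier char_group \<Longrightarrow> (\<lambda>x. \<eta> x * \<nu> x) \<in> carrier char_group"
  by (rule char_groupI) (auto simp: char_mult mult_ac)

lemma char_inverse_closed [simp]:
  "\<eta> \<in> carrier char_group \<Longrightarrow> (\<lambda>x. inverse (\<eta> x)) \<in> carrier char_group"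
  by (rule char_groupI) (auto simp: char_mult)

lemma char_power_closed:
  "\<eta> \<in> carrier char_group \<Longrightarrow> n > 0 \<Longrightarrow> (\<lambda>x. \<eta> x ^ n) \<in> carrier char_group"
  by (rule char_groupI) (auto simp: char_mult power_mult_distrib)

lemma char_prod_closed:
  assumes "finite I" "I \<noteq> {}" "\<And>i. i \<in> I \<Longrightarrow> \<nu> i \<in> carrier char_group"
  shows "(\<lambda>x. \<Prod>i\<in>I. \<nu> i x) \<in> carrier char_group"
  using assms
  by (intro char_groupI) (auto simp: char_mult prod.distrib)

lemma mult_char_group: "\<eta> \<otimes>\<^bsub>char_group\<^esub> \<nu> = (\<lambda>x. \<eta> x * \<nu> x)"
  unfolding char_group_def by simp

lemma one_char_group: "\<one>\<^bsub>char_group\<^esub> = trivial_char"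
  unfolding char_group_def by simp

lemma inv_char_group:
  assumes "\<eta> \<in> carrier char_group"
  shows "inv\<^bsub>char_group\<^esub> \<eta> = (\<lambda>x. inverse (\<eta> x))"
proof (rule char_group.inv_equality)
  show "(\<lambda>x. inverse (\<eta> x)) \<otimes>\<^bsub>char_group\<^esub> \<eta> = \<one>\<^bsub>char_group\<^esub>"
    using assms by (auto simp: mult_char_group one_char_group trivial_char_def)
qed (use assms in auto)

lemma nat_pow_char_group:
  assumes "\<eta> \<in> carrier char_group"
  shows "(\<eta> [^]\<^bsub>char_group\<^esub> (k :: nat)) x = (if x = 0 then 0 else \<eta> x ^ k)"
  using assms
  by (induction k)
    (auto simp: mult_char_group one_char_group trivial_char_def)

lemma int_pow_char_group:
  assumes "\<eta> \<in> carrier char_group"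
  shows "(\<eta> [^]\<^bsub>char_group\<^esub> (k :: int)) x = (if x = 0 then 0 else \<eta> x powi k)"
proof (cases k rule: int_cases2)
  case (nonneg n)
  then show ?thesis
    by (simp only: int_pow_int nat_pow_char_group[OF assms] power_int_of_nat)
next
  case (nonpos n)
  have "(\<eta> [^]\<^bsub>char_group\<^esub> (- int n)) x = inverse (if x = 0 then 0 else \<eta> x ^ n)"
    by (simp only: char_group.int_pow_neg_int[OF assms] nat_pow_char_group[OF assms]
        inv_char_group[OF char_group.nat_pow_closed[OF assms]])
  then show ?thesis
    unfolding nonpos by (simp add: power_int_minus)
qed

lemma finprod_char_group:
  assumes "finite I" "I \<noteq> {}" "\<And>i. i \<in> I \<Longrightarrow> \<nu> i \<in> carrier char_group"
  shows "(\<Otimes>\<^bsub>char_group\<^esub>i\<in>I. \<nu> i) = (\<lambda>x. \<Prod>i\<in>I. \<nu> i x)"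
  using assms
proof (induction I rule: finite_ne_induct)
  case (singleton i)
  then show ?case by simp
next
  case (insert i I)
  then show ?case
    by (subst char_group.finprod_insert) (auto simp: mult_char_group)
qed

lemma nontrivial_charE:
  assumes "\<eta> \<in> carrier char_group" "\<eta> \<noteq> trivial_char"
  obtains u where "u \<noteq> 0" "\<eta> u \<noteq> 1"
  using assms by (auto simp: trivial_char_def fun_eq_iff split: if_splits)

lemma inverse_char_eq_trivial_iff:
  "(\<lambda>x. inverse (\<eta> x)) = trivial_char \<longleftrightarrow> \<eta> = trivial_char"
  unfolding trivial_char_def fun_eq_iff by (metis inverse_inverse_eq inverse_1 inverse_zero)

text \<open>
  Orthogonality: for \<open>u\<close> with \<open>\<eta> u \<noteq> 1\<close>, the substitution of \<open>u x\<close> for \<open>x\<close> shows that the sum equals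
  \<open>\<eta> u\<close> times itself.
\<close>

lemma sum_char:
  assumes \<eta>: "\<eta> \<in> carrier (char_group :: ('k :: {finite, field} \<Rightarrow> qbar) monoid)"
  shows "(\<Sum>x\<in>UNIV - {0}. \<eta> x) = (if \<eta> = trivial_char then of_nat CARD('k) - 1 else 0)"
proof (cases "\<eta> = trivial_char")
  case True
  then have "(\<Sum>x\<in>UNIV - {0}. \<eta> x) = (\<Sum>x\<in>UNIV - {0 :: 'k}. 1)"
    by (intro sum.cong) (auto simp: trivial_char_def)
  then show ?thesis
    using True card_field_gt_1[where 'k = 'k] by (simp add: card_nonzero of_nat_diff)
next
  case False
  obtain u where u: "u \<noteq> 0" "\<eta> u \<noteq> 1" using nontrivial_charE[OF \<eta> False] .
  have "(\<Sum>x\<in>UNIV - {0}. \<eta> x) = (\<Sum>x\<in>UNIV - {0}. \<eta> (u * x))"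
    by (rule sum.reindex_bij_witness[of _ "\<lambda>x. u * x" "\<lambda>x. x / u"]) (use u in auto)
  also have "\<dots> = \<eta> u * (\<Sum>x\<in>UNIV - {0}. \<eta> x)"
    by (simp add: char_mult[OF \<eta>] sum_distrib_left)
  finally show ?thesis using u(2) False by simp
qed

text \<open>
  Write \<open>u = g\<^sup>k\<close> with a generator \<open>g\<close> and \<open>0 < k < q - 1\<close>. Among the \<open>q - 1\<close>
  roots of unity \<open>z\<close> of order dividing \<open>q - 1\<close>, at most \<open>k\<close> satisfy \<open>z\<^sup>k = 1\<close>;
  any other one is the value at \<open>g\<close> of a character, whose value at \<open>u\<close> then differs from \<open>1\<close>.
\<close>

lemma characters_separate:
  fixes u :: "'k :: {finite, field}"
  assumes "u \<noteq> 0" "u \<noteq> 1"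
  obtains \<eta> where "\<eta> \<in> carrier char_group" "\<eta> u \<noteq> 1"
proof -
  define N where "N = CARD('k) - 1"
  have N: "N > 0" using card_field_gt_1[where 'k = 'k] by (simp add: N_def)
  obtain g :: 'k where g: "g \<noteq> 0" and gen: "\<And>x. x \<noteq> 0 \<Longrightarrow> \<exists>i < N. x = g ^ i"
    using cyclic_units unfolding N_def by blast
  obtain k where k: "k < N" "u = g ^ k" using gen[OF assms(1)] by blast
  have k0: "k > 0" using k assms(2) by (cases k) auto
  have card_k: "card {z :: qbar. z ^ k = 1} = k" and card_N: "card {z :: qbar. z ^ N = 1} = N"
    using k0 N by (intro card_nth_roots_alg_closed; simp)+
  have "finite {z :: qbar. z ^ k = 1}"
    using card_k k0 by (intro card_ge_0_finite) simp
  then have "\<not> {z :: qbar. z ^ N = 1} \<subseteq> {z. z ^ k = 1}"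
    using k(1) card_mono[of "{z :: qbar. z ^ k = 1}" "{z. z ^ N = 1}"] card_k card_N by linarith
  then obtain z :: qbar where z: "z ^ N = 1" "z ^ k \<noteq> 1" by blast
  have z0: "z \<noteq> 0" using z(1) N by (auto simp: power_0_left)
  define ind where "ind = (\<lambda>x. SOME i. i < N \<and> x = g ^ i)"
  have ind: "ind x < N" "x = g ^ ind x" if "x \<noteq> 0" for x
    using someI_ex[of "\<lambda>i. i < N \<and> x = g ^ i"] gen[OF that] unfolding ind_def by auto
  \<comment> \<open>As \<open>g\<close> reaches the \<open>N\<close> units with \<open>N\<close> exponents, the exponents are determined modulo \<open>N\<close>.\<close>
  have "(\<lambda>i. g ^ i) ` {..<N} = UNIV - {0}" using gen g by auto
  then have inj: "inj_on (\<lambda>i. g ^ i) {..<N}"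
    by (intro eq_card_imp_inj_on) (simp_all add: card_nonzero N_def)
  have gN: "g ^ N = 1" using power_card_minus_1[OF g] by (simp add: N_def)
  have reduce: "h ^ i = h ^ (i mod N)" if "h ^ N = 1" for h :: "'b :: monoid_mult" and i
  proof -
    have "h ^ i = h ^ (N * (i div N) + i mod N)" by simp
    also have "\<dots> = h ^ (i mod N)" by (simp only: power_add power_mult that) simp
    finally show ?thesis .
  qed
  have ind_pow: "z ^ ind (g ^ i) = z ^ i" for i
  proof -
    have "g ^ (i mod N) = g ^ ind (g ^ i)" using reduce[OF gN, of i] ind(2)[of "g ^ i"] g by simp
    then have "i mod N = ind (g ^ i)"
      using inj ind(1)[of "g ^ i"] g N by (auto dest!: inj_onD)
    then show ?thesis using reduce[OF z(1), of i] by simp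
  qed
  define \<eta> where "\<eta> = (\<lambda>x. if x = 0 then 0 else z ^ ind x)"
  have "\<eta> (x * y) = \<eta> x * \<eta> y" if "x \<noteq> 0" "y \<noteq> 0" for x y
  proof -
    have "x * y = g ^ (ind x + ind y)" using ind(2) that by (metis power_add)
    then have "z ^ ind (x * y) = z ^ (ind x + ind y)" by (simp add: ind_pow)
    then show ?thesis using that by (simp add: \<eta>_def power_add)
  qed
  then have "\<eta> \<in> carrier char_group" using z0 by (intro char_groupI) (auto simp: \<eta>_def)
  moreover have "\<eta> u \<noteq> 1" using k z assms(1) by (simp add: \<eta>_def ind_pow)
  ultimately show ?thesis using that by blast
qed

lemma sum_over_chars_eq_0:
  fixes u :: "'k :: {finite, field}"
  assumes "u \<noteq> 1"
  shows "(\<Sum>\<nu>\<in>carrier char_group. \<nu> u) = 0"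
proof (cases "u = 0")
  case False
  obtain \<eta> where \<eta>: "\<eta> \<in> carrier char_group" "\<eta> u \<noteq> 1"
    using characters_separate[OF False assms] .
  have cancel: "inverse (\<eta> x) * (\<eta> x * \<nu> x) = \<nu> x" "\<eta> x * (inverse (\<eta> x) * \<nu> x) = \<nu> x"
    if "\<nu> \<in> carrier char_group" for \<nu> x
    using \<eta>(1) that by (cases "x = 0"; simp)+
  have "(\<Sum>\<nu>\<in>carrier char_group. \<nu> u) = (\<Sum>\<nu>\<in>carrier char_group. \<eta> u * \<nu> u)"
    by (rule sum.reindex_bij_witness[of _ "\<lambda>\<nu> x. \<eta> x * \<nu> x" "\<lambda>\<nu> x. inverse (\<eta> x) * \<nu> x"])
      (use \<eta>(1) in \<open>simp_all add: cancel\<close>)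
  then show ?thesis using \<eta>(2) by (simp add: sum_distrib_left[symmetric])
qed simp

text \<open>The double sum of \<open>\<nu> x\<close> over all characters and all units, evaluated in both orders.\<close>

lemma card_char_group:
  "card (carrier (char_group :: ('k :: {finite, field} \<Rightarrow> qbar) monoid)) = CARD('k) - 1"
proof -
  let ?C = "carrier (char_group :: ('k \<Rightarrow> qbar) monoid)"
  have "(of_nat (card ?C) :: qbar) = (\<Sum>x\<in>UNIV - {0 :: 'k}. if x = 1 then of_nat (card ?C) else 0)"
    by (simp add: sum.delta')
  also have "\<dots> = (\<Sum>x\<in>UNIV - {0 :: 'k}. \<Sum>\<nu>\<in>?C. \<nu> x)"
    by (intro sum.cong) (auto simp: sum_over_chars_eq_0)
  also have "\<dots> = (\<Sum>\<nu>\<in>?C. \<Sum>x\<in>UNIV - {0}. \<nu> x)" by (rule sum.swap)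
  also have "\<dots> = (\<Sum>\<nu>\<in>?C. if \<nu> = trivial_char then of_nat CARD('k) - 1 else 0)"
    by (intro sum.cong) (auto simp: sum_char)
  also have "\<dots> = of_nat CARD('k) - 1"
    by (simp add: sum.delta' finite_char_group)
  also have "\<dots> = of_nat (CARD('k) - 1)"
    using card_field_gt_1[where 'k = 'k] by (simp add: of_nat_diff)
  finally show ?thesis by (simp only: of_nat_eq_iff)
qed

lemma sum_over_chars:
  fixes u :: "'k :: {finite, field}"
  shows "(\<Sum>\<nu>\<in>carrier char_group. \<nu> u) = (if u = 1 then of_nat CARD('k) - 1 else 0)"
  using sum_over_chars_eq_0[of u] card_field_gt_1[where 'k = 'k]
  by (auto simp: card_char_group of_nat_diff)

text \<open>The order of a generator is the order of the group, which \<open>card_char_group\<close> gives.\<close>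

lemma generator_int_pow_eq_one_iff:
  fixes \<phi> :: "'k :: {finite, field} \<Rightarrow> qbar"
  assumes "\<phi> \<in> carrier char_group" "generate char_group {\<phi>} = carrier char_group"
  shows "\<phi> [^]\<^bsub>char_group\<^esub> (k :: int) = trivial_char \<longleftrightarrow> int (CARD('k) - 1) dvd k"
proof -
  have "char_group.ord \<phi> = CARD('k) - 1"
    using char_group.generate_pow_card[OF assms(1)] assms(2) card_char_group[where 'k = 'k] by simp
  then show ?thesis
    using char_group.int_pow_eq_id[OF assms(1)] by (simp add: one_char_group)
qed

section \<open>Gauss sums\<close>

text \<open>
  Since \<open>inverse 0 = 0\<close>, the function \<open>\<lambda>x. inverse (\<eta> x)\<close> is again a character extended by \<open>0\<close>;
  it serves as \<open>\<eta>\<close> conjugate throughout.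
\<close>

context
  fixes \<psi> :: "'k :: {finite, field} \<Rightarrow> qbar"
  assumes \<psi>: "add_character \<psi>" and nontrivial: "\<exists>x. \<psi> x \<noteq> 1"
begin

lemma add_char_add: "\<psi> (x + y) = \<psi> x * \<psi> y"
  using \<psi> by (simp add: add_character_def)

lemma add_char_0: "\<psi> 0 = 1"
  using \<psi> add_char_add[of 0 0] by (simp add: add_character_def)

lemma add_char_sum: "\<psi> (\<Sum>i\<in>I. f i) = (\<Prod>i\<in>I. \<psi> (f i))"
  by (induction I rule: infinite_finite_induct) (simp_all add: add_char_0 add_char_add)

lemma sum_add_char: "(\<Sum>x\<in>UNIV. \<psi> x) = 0"
proof -
  obtain u where u: "\<psi> u \<noteq> 1" using nontrivial by blast
  have "(\<Sum>x\<in>UNIV. \<psi> x) = (\<Sum>x\<in>UNIV. \<psi> (u + x))"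
    by (rule sum.reindex_bij_witness[of _ "\<lambda>x. u + x" "\<lambda>x. x - u"]) auto
  then show ?thesis using u by (simp add: add_char_add sum_distrib_left[symmetric])
qed

lemma sum_add_char_nonzero:
  "(\<Sum>x\<in>UNIV - {0}. \<psi> (x * u)) = (if u = 0 then of_nat CARD('k) - 1 else - 1)"
proof (cases "u = 0")
  case True
  then show ?thesis
    using card_field_gt_1[where 'k = 'k] by (simp add: add_char_0 card_nonzero of_nat_diff)
next
  case False
  have "(\<Sum>x\<in>UNIV - {0}. \<psi> (x * u)) = (\<Sum>x\<in>UNIV - {0}. \<psi> x)"
    by (rule sum.reindex_bij_witness[of _ "\<lambda>x. x / u" "\<lambda>x. x * u"]) (use False in auto)
  also have "\<dots> = - 1"
    using sum_add_char sum.remove[of UNIV 0 \<psi>] by (simp add: add_char_0 add_eq_0_iff)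
  finally show ?thesis using False by simp
qed

lemma gauss_sum_trivial: "gauss_sum \<psi> trivial_char = 1"
proof -
  have "(\<Sum>x\<in>UNIV - {0}. \<psi> x * trivial_char x) = (\<Sum>x\<in>UNIV - {0}. \<psi> (x * 1))"
    by (intro sum.cong) (auto simp: trivial_char_def)
  then show ?thesis by (simp only: gauss_sum_def sum_add_char_nonzero) simp
qed

lemma sum_add_char_scaled:
  assumes \<eta>: "\<eta> \<in> carrier char_group" and t: "t \<noteq> 0 \<or> \<eta> \<noteq> trivial_char"
  shows "(\<Sum>x\<in>UNIV - {0}. \<psi> (t * x) * \<eta> x) = - inverse (\<eta> t) * gauss_sum \<psi> \<eta>"
proof (cases "t = 0")
  case True
  then show ?thesis using sum_char[OF \<eta>] t \<eta> by (simp add: add_char_0)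
next
  case False
  have "(\<Sum>x\<in>UNIV - {0}. \<psi> (t * x) * \<eta> x) = (\<Sum>x\<in>UNIV - {0}. inverse (\<eta> t) * (\<psi> x * \<eta> x))"
    by (rule sum.reindex_bij_witness[of _ "\<lambda>x. x / t" "\<lambda>x. t * x"])
      (use False \<eta> in \<open>auto simp: char_mult\<close>)
  then show ?thesis by (simp add: gauss_sum_def flip: sum_distrib_left)
qed

text \<open>
  Substituting \<open>x = t y\<close> in the double sum of \<open>\<psi> (x + y) \<eta> (x / y)\<close> leaves a sum over \<open>y\<close> which
  is \<open>q - 1\<close> for \<open>t = -1\<close> and \<open>-1\<close> otherwise. For the trivial character the factor \<open>q\<close> is the
  one that the modified Gauss sum provides.
\<close>

lemma gauss_sum0_mult_gauss_sum_inverse: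
  assumes \<eta>: "\<eta> \<in> carrier char_group"
  shows "gauss_sum0 \<psi> \<eta> * gauss_sum \<psi> (\<lambda>x. inverse (\<eta> x)) = \<eta> (- 1) * of_nat CARD('k)"
proof (cases "\<eta> = trivial_char")
  case True
  then have "(\<lambda>x. inverse (\<eta> x)) = trivial_char" by (simp add: inverse_char_eq_trivial_iff)
  then show ?thesis
    using True by (simp add: gauss_sum0_def gauss_sum_trivial) (simp add: trivial_char_def)
next
  case False
  have "gauss_sum \<psi> \<eta> * gauss_sum \<psi> (\<lambda>x. inverse (\<eta> x)) =
      (\<Sum>y\<in>UNIV - {0}. \<Sum>x\<in>UNIV - {0}. (\<psi> y * inverse (\<eta> y)) * (\<psi> x * \<eta> x))"
    by (subst mult.commute) (simp add: gauss_sum_def sum_product)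
  also have "\<dots> = (\<Sum>y\<in>UNIV - {0}. \<Sum>t\<in>UNIV - {0}. \<eta> t * \<psi> (y * (1 + t)))"
  proof (rule sum.cong[OF refl])
    fix y :: 'k assume y: "y \<in> UNIV - {0}"
    show "(\<Sum>x\<in>UNIV - {0}. (\<psi> y * inverse (\<eta> y)) * (\<psi> x * \<eta> x)) =
        (\<Sum>t\<in>UNIV - {0}. \<eta> t * \<psi> (y * (1 + t)))"
      by (rule sum.reindex_bij_witness[of _ "\<lambda>t. t * y" "\<lambda>x. x / y"])
        (use y \<eta> in \<open>auto simp: divide_inverse char_mult char_inverse distrib_left add_char_add mult_ac\<close>)
  qed
  also have "\<dots> = (\<Sum>t\<in>UNIV - {0}. \<eta> t * (\<Sum>y\<in>UNIV - {0}. \<psi> (y * (1 + t))))"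
    by (subst sum.swap) (simp add: sum_distrib_left)
  also have "\<dots> = (\<Sum>t\<in>UNIV - {0}. (if t = - 1 then \<eta> t * of_nat CARD('k) else 0) - \<eta> t)"
    by (intro sum.cong) (auto simp: sum_add_char_nonzero right_diff_distrib add_eq_0_iff)
  also have "\<dots> = \<eta> (- 1) * of_nat CARD('k)"
    using sum_char[OF \<eta>] False by (simp add: sum_subtractf sum.delta)
  finally show ?thesis using False by (simp add: gauss_sum0_def)
qed

lemma gauss_sum_inverse:
  assumes "\<eta> \<in> carrier char_group" "\<eta> \<noteq> trivial_char"
  shows "gauss_sum \<psi> \<eta> * gauss_sum \<psi> (\<lambda>x. inverse (\<eta> x)) = \<eta> (- 1) * of_nat CARD('k)"
  using gauss_sum0_mult_gauss_sum_inverse[OF assms(1)] assms(2) by (simp add: gauss_sum0_def)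

lemma gauss_sum0_nonzero: "\<eta> \<in> carrier char_group \<Longrightarrow> gauss_sum0 \<psi> \<eta> \<noteq> 0"
  using gauss_sum0_mult_gauss_sum_inverse[of \<eta>] by auto

lemma gauss_sum_nonzero: "\<eta> \<in> carrier char_group \<Longrightarrow> gauss_sum \<psi> \<eta> \<noteq> 0"
  using gauss_sum0_nonzero[of \<eta>] by (auto simp: gauss_sum0_def)

text \<open>
  Reflection turns a quotient of modified Gauss sums into a quotient of plain ones at the conjugate
  characters, upside down; the factors \<open>q\<close> and the values \<open>\<gamma> (- 1)\<close> cancel.
\<close>

lemma poch0_eq:
  assumes \<gamma>: "\<gamma> \<in> carrier char_group" and \<nu>: "\<nu> \<in> carrier char_group"
  shows "poch0 \<psi> \<gamma> \<nu> = \<nu> (- 1) * gauss_sum \<psi> (\<lambda>x. inverse (\<gamma> x)) /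
           gauss_sum \<psi> (\<lambda>x. inverse (\<gamma> x) * inverse (\<nu> x))"
proof -
  have *: "gauss_sum0 \<psi> \<eta> = \<eta> (- 1) * of_nat CARD('k) / gauss_sum \<psi> (\<lambda>x. inverse (\<eta> x))"
    if "\<eta> \<in> carrier char_group" for \<eta>
    using gauss_sum0_mult_gauss_sum_inverse[OF that] gauss_sum_nonzero that
    by (simp add: nonzero_eq_divide_eq)
  show ?thesis
    using \<gamma> \<nu> gauss_sum_nonzero[of "\<lambda>x. inverse (\<gamma> x)"] gauss_sum_nonzero[of "\<lambda>x. inverse (\<gamma> x) * inverse (\<nu> x)"]
    by (simp add: poch0_def mult_char_group * field_simps)
qed

text \<open>
  Fourier inversion on the group of units, with the Gauss sums as the Fourier coefficients of \<open>\<psi>\<close>.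
  It trades a value of \<open>\<psi>\<close>, where the variables occur additively, for characters, where they separate.
\<close>

lemma add_char_expansion:
  assumes t: "t \<noteq> 0"
  shows "\<psi> t = 1 / (1 - of_nat CARD('k)) *
    (\<Sum>\<nu>\<in>carrier char_group. gauss_sum \<psi> (\<lambda>x. inverse (\<nu> x)) * \<nu> t)"
proof -
  have "(\<Sum>\<nu>\<in>carrier char_group. gauss_sum \<psi> (\<lambda>x. inverse (\<nu> x)) * \<nu> t) =
      - (\<Sum>\<nu>\<in>carrier char_group. \<Sum>x\<in>UNIV - {0}. \<psi> x * \<nu> (t / x))"
    by (simp add: gauss_sum_def sum_distrib_left sum_distrib_right char_mult char_inverse divide_inverse mult_ac
        flip: sum_negf)
  also have "\<dots> = - (\<Sum>x\<in>UNIV - {0}. \<psi> x * (\<Sum>\<nu>\<in>carrier char_group. \<nu> (t / x)))"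
    by (subst sum.swap) (simp add: sum_distrib_left)
  also have "\<dots> = - (\<Sum>x\<in>UNIV - {0}. if x = t then \<psi> x * (of_nat CARD('k) - 1) else 0)"
    by (intro arg_cong[of _ _ uminus] sum.cong) (auto simp: sum_over_chars)
  also have "\<dots> = (1 - of_nat CARD('k)) * \<psi> t"
    using t by (simp add: sum.delta algebra_simps)
  finally show ?thesis
    using card_field_gt_1[where 'k = 'k] by (simp add: of_nat_eq_1_iff)
qed

section \<open>Jacobi sums\<close>

text \<open>
  Expanding the product of the Gauss sums and grouping the tuples by their sum \<open>s\<close> gives
  a sum of \<open>\<psi> s\<close> times \<open>P s\<close>, the sum of \<open>\<Prod>i. \<eta> i (x i)\<close> over the tuples with sum \<open>s\<close>. By
  homogeneity \<open>P s\<close> is \<open>P 1\<close> times the value of the product character at \<open>s\<close> for \<open>s \<noteq> 0\<close>; and \<open>P 0\<close>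
  is then known because the total of \<open>P\<close> contains a vanishing character sum as a factor.
\<close>

lemma prod_gauss_sum:
  fixes \<eta> :: "'i :: finite \<Rightarrow> 'k \<Rightarrow> qbar"
  assumes \<eta>: "\<And>i. \<eta> i \<in> carrier char_group" and i0: "\<eta> i0 \<noteq> trivial_char"
  shows "(\<Prod>i\<in>UNIV. gauss_sum \<psi> (\<eta> i)) =
    jacobi_sum \<eta> * gauss_sum0 \<psi> (\<lambda>x. \<Prod>i\<in>UNIV. \<eta> i x)"
proof -
  define \<theta> where "\<theta> = (\<lambda>x. \<Prod>i\<in>UNIV. \<eta> i x)"
  have \<theta>: "\<theta> \<in> carrier char_group" unfolding \<theta>_def by (intro char_prod_closed) (use \<eta> in auto)
  define T where "T = {x :: 'i \<Rightarrow> 'k. \<forall>i. x i \<noteq> 0}"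
  have T: "T = Pi\<^sub>E UNIV (\<lambda>_. UNIV - {0})" by (auto simp: T_def PiE_UNIV_domain Pi_def)
  define P where "P = (\<lambda>s. \<Sum>x | x \<in> T \<and> (\<Sum>i\<in>UNIV. x i) = s. \<Prod>i\<in>UNIV. \<eta> i (x i))"
  have group: "(\<Sum>s\<in>UNIV. f s * P s) = (\<Sum>x\<in>T. f (\<Sum>i\<in>UNIV. x i) * (\<Prod>i\<in>UNIV. \<eta> i (x i)))" for f
  proof -
    have "(\<Sum>s\<in>UNIV. f s * P s) = (\<Sum>s\<in>UNIV. \<Sum>x | x \<in> T \<and> (\<Sum>i\<in>UNIV. x i) = s.
        f (\<Sum>i\<in>UNIV. x i) * (\<Prod>i\<in>UNIV. \<eta> i (x i)))"
      unfolding P_def by (intro sum.cong refl) (simp add: sum_distrib_left)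
    also have "\<dots> = (\<Sum>x\<in>T. f (\<Sum>i\<in>UNIV. x i) * (\<Prod>i\<in>UNIV. \<eta> i (x i)))"
      by (intro sum.group) auto
    finally show ?thesis .
  qed
  have scale: "P s = \<theta> s * P 1" if s: "s \<noteq> 0" for s
  proof -
    have "P s = (\<Sum>x | x \<in> T \<and> (\<Sum>i\<in>UNIV. x i) = 1. \<theta> s * (\<Prod>i\<in>UNIV. \<eta> i (x i)))"
      unfolding P_def
      by (rule sum.reindex_bij_witness[of _ "\<lambda>x i. s * x i" "\<lambda>x i. x i / s"])
        (use s \<eta> in \<open>auto simp: T_def \<theta>_def sum_distrib_left[symmetric] sum_divide_distrib[symmetric]
          prod.distrib[symmetric] simp flip: char_mult\<close>)
    then show ?thesis by (simp add: P_def sum_distrib_left)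
  qed
  have split: "(\<Sum>s\<in>UNIV. f s * P s) = f 0 * P 0 + P 1 * (\<Sum>s\<in>UNIV - {0}. f s * \<theta> s)" for f :: "'k \<Rightarrow> qbar"
  proof -
    have "f s * P s = P 1 * (f s * \<theta> s)" if "s \<in> UNIV - {0}" for s
      using scale[of s] that by (simp add: mult_ac)
    then have "(\<Sum>s\<in>UNIV - {0}. f s * P s) = P 1 * (\<Sum>s\<in>UNIV - {0}. f s * \<theta> s)"
      by (simp only: sum_distrib_left cong: sum.cong)
    then show ?thesis by (subst sum.remove[of _ 0]) auto
  qed
  have "(\<Sum>s\<in>UNIV. 1 * P s) = (\<Sum>x\<in>T. \<Prod>i\<in>UNIV. \<eta> i (x i))"
    by (subst group) simp
  also have "\<dots> = (\<Prod>i\<in>UNIV. \<Sum>x\<in>UNIV - {0}. \<eta> i x)"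
    unfolding T by (rule prod_sum_PiE[symmetric]) auto
  also have "\<dots> = 0"
    using sum_char[OF \<eta>, of i0] i0 by (intro prod_zero) auto
  finally have P0: "P 0 = - P 1 * (\<Sum>s\<in>UNIV - {0}. \<theta> s)"
    unfolding split by (simp add: add_eq_0_iff)
  have "(\<Prod>i\<in>UNIV. gauss_sum \<psi> (\<eta> i)) = (- 1) ^ CARD('i) * (\<Prod>i\<in>UNIV. \<Sum>x\<in>UNIV - {0}. \<psi> x * \<eta> i x)"
    by (simp add: gauss_sum_def prod_uminus)
  also have "(\<Prod>i\<in>UNIV. \<Sum>x\<in>UNIV - {0}. \<psi> x * \<eta> i x) = (\<Sum>x\<in>T. \<Prod>i\<in>UNIV. \<psi> (x i) * \<eta> i (x i))"
    unfolding T by (rule prod_sum_PiE) auto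
  also have "\<dots> = (\<Sum>s\<in>UNIV. \<psi> s * P s)"
    by (subst group) (simp add: add_char_sum prod.distrib)
  also have "\<dots> = P 0 - P 1 * gauss_sum \<psi> \<theta>"
    unfolding split by (simp add: add_char_0 gauss_sum_def)
  also have "\<dots> = - P 1 * gauss_sum0 \<psi> \<theta>"
    unfolding P0 sum_char[OF \<theta>] by (simp add: gauss_sum0_def gauss_sum_trivial algebra_simps)
  also have "(- 1) ^ CARD('i) * (- P 1 * gauss_sum0 \<psi> \<theta>) = (- 1) ^ (CARD('i) - 1) * P 1 * gauss_sum0 \<psi> \<theta>"
    by (subst power_eq_if) simp
  also have "(- 1) ^ (CARD('i) - 1) * P 1 = jacobi_sum \<eta>"
    by (simp add: jacobi_sum_def P_def T_def)
  finally show ?thesis by (simp only: \<theta>_def)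
qed

end

section \<open>The character sum behind Lauricella's function\<close>

lemma char_minus: "\<eta> \<in> carrier char_group \<Longrightarrow> \<eta> (- x) = \<eta> (- 1) * \<eta> x"
  using char_mult[of \<eta> "- 1" x] by simp

lemma inverse_char_minus_1: "\<eta> \<in> carrier char_group \<Longrightarrow> inverse (\<eta> (- 1)) = \<eta> (- 1)"
  using char_minus_1_squared[of \<eta>] by (rule inverse_unique)

lemma prod_option:
  "(\<Prod>i\<in>UNIV. f i) = f None * (\<Prod>i\<in>UNIV. f (Some i))"
  for f :: "'n :: finite option \<Rightarrow> 'a :: comm_monoid_mult"
  by (simp add: UNIV_option_conv prod.reindex)

lemma poch0_trivial_char:
  fixes \<psi> :: "'k :: {finite, field} \<Rightarrow> qbar"
  assumes "add_character \<psi>" "\<exists>x. \<psi> x \<noteq> 1" "\<nu> \<in> carrier char_group"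
  shows "poch0 \<psi> trivial_char \<nu> = \<nu> (- 1) / gauss_sum \<psi> (\<lambda>x. inverse (\<nu> x))"
proof -
  have "(\<lambda>x. inverse (trivial_char x) * inverse (\<nu> x)) = (\<lambda>x. inverse (\<nu> x))"
    using assms(3) by (auto simp: trivial_char_def)
  moreover have "(\<lambda>x. inverse (trivial_char x)) = (trivial_char :: 'k \<Rightarrow> qbar)"
    by (simp add: inverse_char_eq_trivial_iff)
  ultimately show ?thesis
    using poch0_eq[OF assms(1,2) trivial_char_closed assms(3)] gauss_sum_trivial[OF assms(1,2)]
    by simp
qed

context
  fixes \<psi> :: "'k :: {finite, field} \<Rightarrow> qbar"
  assumes \<psi>: "add_character \<psi>" and nontrivial: "\<exists>x. \<psi> x \<noteq> 1"
begin

text \<open>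
  Only the factor with \<open>l / x\<close> is expanded in characters; the sum over \<open>x\<close> that is left for each \<open>\<nu>\<close>
  is then a Gauss sum of \<open>\<Gamma>\<close> times \<open>\<nu>\<close> conjugate. The signs \<open>\<nu> (- 1)\<close> from \<open>- s\<close> and from \<open>- t\<close> cancel.
\<close>

lemma kloosterman_sum_expansion:
  assumes \<Gamma>: "\<Gamma> \<in> carrier char_group" and "s \<noteq> 0" "t \<noteq> 0" "l \<noteq> 0"
  shows "(\<Sum>x\<in>UNIV - {0}. \<Gamma> x * \<psi> (- (t * x)) * \<psi> (- (s * l / x))) =
    - \<Gamma> (- 1) / (1 - of_nat CARD('k)) * inverse (\<Gamma> t) *
    (\<Sum>\<nu>\<in>carrier char_group.
       gauss_sum \<psi> (\<lambda>x. inverse (\<nu> x)) * gauss_sum \<psi> (\<lambda>x. \<Gamma> x * inverse (\<nu> x)) * \<nu> l * \<nu> (s * t))"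
proof -
  let ?g = "\<lambda>\<nu>. gauss_sum \<psi> (\<lambda>x. inverse (\<nu> x))"
  let ?h = "\<lambda>\<nu>. gauss_sum \<psi> (\<lambda>x. \<Gamma> x * inverse (\<nu> x))"
  let ?c = "1 / (1 - of_nat CARD('k)) :: qbar"
  have "(\<Sum>x\<in>UNIV - {0}. \<Gamma> x * \<psi> (- (t * x)) * \<psi> (- (s * l / x))) =
      (\<Sum>x\<in>UNIV - {0}. \<Sum>\<nu>\<in>carrier char_group.
        ?c * (\<Gamma> x * \<psi> (- (t * x)) * (?g \<nu> * \<nu> (- (s * l / x)))))"
  proof (rule sum.cong[OF refl])
    fix x :: 'k assume "x \<in> UNIV - {0}"
    then have "- (s * l / x) \<noteq> 0" using assms by simp
    from add_char_expansion[OF \<psi> nontrivial this]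
    have "\<psi> (- (s * l / x)) = ?c * (\<Sum>\<nu>\<in>carrier char_group. ?g \<nu> * \<nu> (- (s * l / x)))" .
    then show "\<Gamma> x * \<psi> (- (t * x)) * \<psi> (- (s * l / x)) =
        (\<Sum>\<nu>\<in>carrier char_group. ?c * (\<Gamma> x * \<psi> (- (t * x)) * (?g \<nu> * \<nu> (- (s * l / x)))))"
      by (simp only: sum_distrib_left mult.left_commute)
  qed
  also have "\<dots> = (\<Sum>\<nu>\<in>carrier char_group. \<Sum>x\<in>UNIV - {0}.
        ?c * (\<Gamma> x * \<psi> (- (t * x)) * (?g \<nu> * \<nu> (- (s * l / x)))))"
    by (rule sum.swap)
  also have "\<dots> = (\<Sum>\<nu>\<in>carrier char_group.
      - \<Gamma> (- 1) / (1 - of_nat CARD('k)) * inverse (\<Gamma> t) * (?g \<nu> * ?h \<nu> * \<nu> l * \<nu> (s * t)))"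
  proof (rule sum.cong[OF refl])
    fix \<nu> :: "'k \<Rightarrow> qbar" assume \<nu>: "\<nu> \<in> carrier char_group"
    have \<nu>_arg: "\<nu> (- (s * l / x)) = \<nu> (- 1) * \<nu> (s * l) * inverse (\<nu> x)" for x
      using char_minus[OF \<nu>, of "s * l / x"]
      by (simp add: divide_inverse char_mult[OF \<nu>] char_inverse[OF \<nu>] mult.assoc)
    have "(\<Sum>x\<in>UNIV - {0}. ?c * (\<Gamma> x * \<psi> (- (t * x)) * (?g \<nu> * \<nu> (- (s * l / x))))) =
        (\<Sum>x\<in>UNIV - {0}. ?c * ?g \<nu> * \<nu> (- 1) * \<nu> (s * l) * (\<psi> (- t * x) * (\<Gamma> x * inverse (\<nu> x))))"
      unfolding \<nu>_arg by (simp add: mult_ac)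
    also have "\<dots> = ?c * ?g \<nu> * \<nu> (- 1) * \<nu> (s * l) *
        (\<Sum>x\<in>UNIV - {0}. \<psi> (- t * x) * (\<Gamma> x * inverse (\<nu> x)))"
      by (simp only: sum_distrib_left)
    also have "(\<Sum>x\<in>UNIV - {0}. \<psi> (- t * x) * (\<Gamma> x * inverse (\<nu> x))) =
        - inverse (\<Gamma> (- t) * inverse (\<nu> (- t))) * ?h \<nu>"
      using \<Gamma> \<nu> assms by (intro sum_add_char_scaled[OF \<psi> nontrivial]) simp_all
    also have "inverse (\<Gamma> (- t) * inverse (\<nu> (- t))) = \<Gamma> (- 1) * inverse (\<Gamma> t) * \<nu> (- 1) * \<nu> t"
      by (simp add: char_minus[OF \<Gamma>, of t] char_minus[OF \<nu>, of t] inverse_char_minus_1[OF \<Gamma>])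
    also have "?c * ?g \<nu> * \<nu> (- 1) * \<nu> (s * l) *
          (- (\<Gamma> (- 1) * inverse (\<Gamma> t) * \<nu> (- 1) * \<nu> t) * ?h \<nu>) =
        (\<nu> (- 1) * \<nu> (- 1)) *
          (- \<Gamma> (- 1) / (1 - of_nat CARD('k)) * inverse (\<Gamma> t) * (?g \<nu> * ?h \<nu> * \<nu> l * \<nu> (s * t)))"
      by (simp add: char_mult[OF \<nu>] mult_ac)
    finally show "(\<Sum>x\<in>UNIV - {0}. ?c * (\<Gamma> x * \<psi> (- (t * x)) * (?g \<nu> * \<nu> (- (s * l / x))))) =
        - \<Gamma> (- 1) / (1 - of_nat CARD('k)) * inverse (\<Gamma> t) * (?g \<nu> * ?h \<nu> * \<nu> l * \<nu> (s * t))"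
      by (simp only: char_minus_1_squared[OF \<nu>] mult_1_left)
  qed
  finally show ?thesis by (simp only: sum_distrib_left)
qed

context
  fixes A B :: "'k \<Rightarrow> qbar" and \<Gamma> :: "'n :: finite \<Rightarrow> 'k \<Rightarrow> qbar" and lam :: "'n \<Rightarrow> 'k"
  assumes A: "A \<in> carrier char_group" "A \<noteq> trivial_char"
    and B: "B \<in> carrier char_group" "B \<noteq> trivial_char"
    and \<Gamma>: "\<And>i. \<Gamma> i \<in> carrier char_group"
    and lam: "\<And>i. lam i \<noteq> 0"
begin

text \<open>
  A nontrivial character value \<open>A u\<close> times the Gauss sum of its conjugate is a sum of additive
  character values \<open>\<psi> (u t)\<close>, at \<open>u = 0\<close> as well. As the arguments of \<open>A\<close> and \<open>B\<close> are sums of terms in a single \<open>x i\<close> each,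
  the sum over all tuples becomes, for fixed \<open>s\<close> and \<open>t\<close>, a product of twisted Kloosterman sums.
\<close>

lemma sum_times_gauss_sums:
  "(\<Sum>x | \<forall>i. x i \<noteq> 0. (\<Prod>i\<in>UNIV. \<Gamma> i (x i)) * A (1 - (\<Sum>i\<in>UNIV. x i)) *
        B (1 - (\<Sum>i\<in>UNIV. lam i / x i))) *
      (gauss_sum \<psi> (\<lambda>x. inverse (A x)) * gauss_sum \<psi> (\<lambda>x. inverse (B x))) =
    (\<Sum>s\<in>UNIV - {0}. \<Sum>t\<in>UNIV - {0}. (\<psi> s * inverse (B s)) * (\<psi> t * inverse (A t)) *
      (\<Prod>i\<in>UNIV. \<Sum>x\<in>UNIV - {0}. \<Gamma> i x * \<psi> (- (t * x)) * \<psi> (- (s * lam i / x))))"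
proof -
  let ?u = "\<lambda>x :: 'n \<Rightarrow> 'k. 1 - (\<Sum>i\<in>UNIV. x i)"
  let ?v = "\<lambda>x :: 'n \<Rightarrow> 'k. 1 - (\<Sum>i\<in>UNIV. lam i / x i)"
  let ?T = "{x :: 'n \<Rightarrow> 'k. \<forall>i. x i \<noteq> 0}"
  have T: "?T = Pi\<^sub>E UNIV (\<lambda>_. UNIV - {0})" by (auto simp: PiE_UNIV_domain Pi_def)
  have expand: "\<eta> u * gauss_sum \<psi> (\<lambda>x. inverse (\<eta> x)) = - (\<Sum>t\<in>UNIV - {0}. \<psi> (u * t) * inverse (\<eta> t))"
    if "\<eta> \<in> carrier char_group" "\<eta> \<noteq> trivial_char" for \<eta> u
    using sum_add_char_scaled[OF \<psi> nontrivial, of "\<lambda>x. inverse (\<eta> x)" u] that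
    by (simp add: inverse_char_eq_trivial_iff)
  have factor: "(\<Prod>i\<in>UNIV. \<Gamma> i (x i)) * (\<psi> (?v x * s) * \<psi> (?u x * t)) =
      \<psi> s * \<psi> t * (\<Prod>i\<in>UNIV. \<Gamma> i (x i) * \<psi> (- (t * x i)) * \<psi> (- (s * lam i / x i)))" for x s t
  proof -
    have "\<psi> (?u x * t) = \<psi> (t + (\<Sum>i\<in>UNIV. - (t * x i)))"
      by (simp add: algebra_simps sum_distrib_left sum_negf)
    moreover have "\<psi> (?v x * s) = \<psi> (s + (\<Sum>i\<in>UNIV. - (s * lam i / x i)))"
      by (simp add: algebra_simps sum_distrib_left sum_negf)
    ultimately show ?thesis
      by (simp only: add_char_add[OF \<psi> nontrivial] add_char_sum[OF \<psi> nontrivial] prod.distrib mult_ac)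
  qed
  have "(\<Sum>x\<in>?T. (\<Prod>i\<in>UNIV. \<Gamma> i (x i)) * A (?u x) * B (?v x)) *
      (gauss_sum \<psi> (\<lambda>x. inverse (A x)) * gauss_sum \<psi> (\<lambda>x. inverse (B x))) =
      (\<Sum>x\<in>?T. (\<Prod>i\<in>UNIV. \<Gamma> i (x i)) *
        ((B (?v x) * gauss_sum \<psi> (\<lambda>x. inverse (B x))) * (A (?u x) * gauss_sum \<psi> (\<lambda>x. inverse (A x)))))"
    unfolding sum_distrib_right by (intro sum.cong refl) (simp only: mult_ac)
  also have "\<dots> = (\<Sum>x\<in>?T. \<Sum>s\<in>UNIV - {0}. \<Sum>t\<in>UNIV - {0}. (inverse (B s) * inverse (A t)) *
        ((\<Prod>i\<in>UNIV. \<Gamma> i (x i)) * (\<psi> (?v x * s) * \<psi> (?u x * t))))"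
    by (simp only: expand[OF A] expand[OF B] minus_mult_minus sum_product,
        simp only: sum_distrib_left mult_ac)
  also have "\<dots> = (\<Sum>s\<in>UNIV - {0}. \<Sum>t\<in>UNIV - {0}. \<Sum>x\<in>?T. (inverse (B s) * inverse (A t)) *
        ((\<Prod>i\<in>UNIV. \<Gamma> i (x i)) * (\<psi> (?v x * s) * \<psi> (?u x * t))))"
    by (subst sum.swap, rule sum.cong[OF refl], rule sum.swap)
  also have "\<dots> = (\<Sum>s\<in>UNIV - {0}. \<Sum>t\<in>UNIV - {0}. (\<psi> s * inverse (B s)) * (\<psi> t * inverse (A t)) *
      (\<Sum>x\<in>?T. \<Prod>i\<in>UNIV. \<Gamma> i (x i) * \<psi> (- (t * x i)) * \<psi> (- (s * lam i / x i))))"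
    unfolding factor sum_distrib_left by (simp only: mult_ac)
  also have "\<dots> = (\<Sum>s\<in>UNIV - {0}. \<Sum>t\<in>UNIV - {0}. (\<psi> s * inverse (B s)) * (\<psi> t * inverse (A t)) *
      (\<Prod>i\<in>UNIV. \<Sum>x\<in>UNIV - {0}. \<Gamma> i x * \<psi> (- (t * x)) * \<psi> (- (s * lam i / x))))"
    unfolding T by (subst prod_sum_PiE) auto
  finally show ?thesis .
qed

text \<open>
  The factors of a summand that the tuple of characters determines index by index. What else a
  summand depends on is the product of the tuple, through two Gauss sums.
\<close>

definition lauricella_coeff :: "('n \<Rightarrow> 'k \<Rightarrow> qbar) \<Rightarrow> qbar" where
  "lauricella_coeff \<nu> = (\<Prod>i\<in>UNIV. gauss_sum \<psi> (\<lambda>x. inverse (\<nu> i x)) *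
     gauss_sum \<psi> (\<lambda>x. \<Gamma> i x * inverse (\<nu> i x)) * \<nu> i (lam i))"

abbreviation tuples :: "('n \<Rightarrow> 'k \<Rightarrow> qbar) set" where
  "tuples \<equiv> {\<nu>. \<forall>i. \<nu> i \<in> carrier char_group}"

lemma prod_kloosterman_sums:
  assumes "s \<noteq> 0" "t \<noteq> 0"
  shows "(\<Prod>i\<in>UNIV. \<Sum>x\<in>UNIV - {0}. \<Gamma> i x * \<psi> (- (t * x)) * \<psi> (- (s * lam i / x))) =
    (- 1) ^ CARD('n) / (1 - of_nat CARD('k)) ^ CARD('n) * (\<Prod>i\<in>UNIV. \<Gamma> i (- 1)) *
    (\<Sum>\<nu>\<in>tuples. lauricella_coeff \<nu> * ((\<Prod>i\<in>UNIV. inverse (\<Gamma> i t)) * (\<Prod>i\<in>UNIV. \<nu> i t) * (\<Prod>i\<in>UNIV. \<nu> i s)))"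
proof -
  let ?K = "\<lambda>i. \<Sum>\<nu>\<in>carrier char_group. gauss_sum \<psi> (\<lambda>x. inverse (\<nu> x)) *
     gauss_sum \<psi> (\<lambda>x. \<Gamma> i x * inverse (\<nu> x)) * \<nu> (lam i) * \<nu> (s * t)"
  have tuples: "tuples = Pi\<^sub>E UNIV (\<lambda>_. carrier char_group)" by (auto simp: PiE_UNIV_domain Pi_def)
  have "(\<Prod>i\<in>UNIV. \<Sum>x\<in>UNIV - {0}. \<Gamma> i x * \<psi> (- (t * x)) * \<psi> (- (s * lam i / x))) =
      (\<Prod>i\<in>UNIV. (- 1 / (1 - of_nat CARD('k))) * \<Gamma> i (- 1) * inverse (\<Gamma> i t) * ?K i)"
    by (intro prod.cong refl, subst kloosterman_sum_expansion[OF \<Gamma> assms lam]) simp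
  also have "\<dots> = (- 1) ^ CARD('n) / (1 - of_nat CARD('k)) ^ CARD('n) * (\<Prod>i\<in>UNIV. \<Gamma> i (- 1)) *
      ((\<Prod>i\<in>UNIV. inverse (\<Gamma> i t)) * (\<Prod>i\<in>UNIV. ?K i))"
    by (simp only: prod.distrib prod_constant power_divide mult.assoc)
  also have "(\<Prod>i\<in>UNIV. ?K i) = (\<Sum>\<nu>\<in>tuples. \<Prod>i\<in>UNIV. gauss_sum \<psi> (\<lambda>x. inverse (\<nu> i x)) *
     gauss_sum \<psi> (\<lambda>x. \<Gamma> i x * inverse (\<nu> i x)) * \<nu> i (lam i) * \<nu> i (s * t))"
    unfolding tuples by (rule prod_sum_PiE) (auto simp: finite_char_group)
  also have "\<dots> = (\<Sum>\<nu>\<in>tuples. lauricella_coeff \<nu> * ((\<Prod>i\<in>UNIV. \<nu> i t) * (\<Prod>i\<in>UNIV. \<nu> i s)))"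
    by (intro sum.cong refl) (simp add: lauricella_coeff_def prod.distrib char_mult mult_ac)
  also have "(\<Prod>i\<in>UNIV. inverse (\<Gamma> i t)) * \<dots> = (\<Sum>\<nu>\<in>tuples. lauricella_coeff \<nu> *
      ((\<Prod>i\<in>UNIV. inverse (\<Gamma> i t)) * (\<Prod>i\<in>UNIV. \<nu> i t) * (\<Prod>i\<in>UNIV. \<nu> i s)))"
    by (simp only: sum_distrib_left mult_ac)
  finally show ?thesis .
qed

text \<open>
  The variables \<open>s\<close> and \<open>t\<close> now occur in characters and in \<open>\<psi> s\<close> and \<open>\<psi> t\<close> only, so summing over
  them yields the two Gauss sums that depend on the product of the \<open>\<nu> i\<close>.
\<close>

lemma sum_times_gauss_sums_expansion:
  "(\<Sum>x | \<forall>i. x i \<noteq> 0. (\<Prod>i\<in>UNIV. \<Gamma> i (x i)) * A (1 - (\<Sum>i\<in>UNIV. x i)) *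
        B (1 - (\<Sum>i\<in>UNIV. lam i / x i))) *
      (gauss_sum \<psi> (\<lambda>x. inverse (A x)) * gauss_sum \<psi> (\<lambda>x. inverse (B x))) =
    (- 1) ^ CARD('n) / (1 - of_nat CARD('k)) ^ CARD('n) * (\<Prod>i\<in>UNIV. \<Gamma> i (- 1)) *
    (\<Sum>\<nu>\<in>tuples. lauricella_coeff \<nu> *
      (gauss_sum \<psi> (\<lambda>x. inverse (A x) * (\<Prod>i\<in>UNIV. inverse (\<Gamma> i x)) * (\<Prod>i\<in>UNIV. \<nu> i x)) *
       gauss_sum \<psi> (\<lambda>x. inverse (B x) * (\<Prod>i\<in>UNIV. \<nu> i x))))"
proof -
  let ?c = "(- 1) ^ CARD('n) / (1 - of_nat CARD('k)) ^ CARD('n) * (\<Prod>i\<in>UNIV. \<Gamma> i (- 1)) :: qbar"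
  let ?a = "\<lambda>\<nu> x. inverse (A x) * (\<Prod>i\<in>UNIV. inverse (\<Gamma> i x)) * (\<Prod>i\<in>UNIV. \<nu> i x)"
  let ?b = "\<lambda>\<nu> x. inverse (B x) * (\<Prod>i\<in>UNIV. \<nu> i x)"
  have "(\<Sum>s\<in>UNIV - {0}. \<Sum>t\<in>UNIV - {0}. (\<psi> s * inverse (B s)) * (\<psi> t * inverse (A t)) *
      (\<Prod>i\<in>UNIV. \<Sum>x\<in>UNIV - {0}. \<Gamma> i x * \<psi> (- (t * x)) * \<psi> (- (s * lam i / x)))) =
      (\<Sum>s\<in>UNIV - {0}. \<Sum>t\<in>UNIV - {0}. \<Sum>\<nu>\<in>tuples. ?c * lauricella_coeff \<nu> * ((\<psi> s * ?b \<nu> s) * (\<psi> t * ?a \<nu> t)))"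
  proof (intro sum.cong[OF refl])
    fix s t :: 'k assume "s \<in> UNIV - {0}" "t \<in> UNIV - {0}"
    then have st: "s \<noteq> 0" "t \<noteq> 0" by auto
    show "(\<psi> s * inverse (B s)) * (\<psi> t * inverse (A t)) *
      (\<Prod>i\<in>UNIV. \<Sum>x\<in>UNIV - {0}. \<Gamma> i x * \<psi> (- (t * x)) * \<psi> (- (s * lam i / x))) =
      (\<Sum>\<nu>\<in>tuples. ?c * lauricella_coeff \<nu> * ((\<psi> s * ?b \<nu> s) * (\<psi> t * ?a \<nu> t)))"
      unfolding prod_kloosterman_sums[OF st] sum_distrib_left
      by (intro sum.cong refl) (simp only: mult_ac)
  qed
  also have "\<dots> = (\<Sum>\<nu>\<in>tuples. \<Sum>s\<in>UNIV - {0}. \<Sum>t\<in>UNIV - {0}. ?c * lauricella_coeff \<nu> * ((\<psi> s * ?b \<nu> s) * (\<psi> t * ?a \<nu> t)))"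
    by (simp only: sum.swap[of _ tuples "UNIV - {0}"])
  also have "\<dots> = (\<Sum>\<nu>\<in>tuples. ?c * lauricella_coeff \<nu> *
      ((\<Sum>s\<in>UNIV - {0}. \<psi> s * ?b \<nu> s) * (\<Sum>t\<in>UNIV - {0}. \<psi> t * ?a \<nu> t)))"
    by (simp only: sum_product, simp only: sum_distrib_left)
  also have "\<dots> = ?c * (\<Sum>\<nu>\<in>tuples. lauricella_coeff \<nu> * (gauss_sum \<psi> (?a \<nu>) * gauss_sum \<psi> (?b \<nu>)))"
    unfolding gauss_sum_def minus_mult_minus sum_distrib_left[of ?c] by (simp only: mult_ac)
  finally show ?thesis unfolding sum_times_gauss_sums .
qed

text \<open>
  By the reflection formula the denominators in Lauricella's function become numerators
  with conjugate characters; the signs \<open>\<nu> (-1)\<close> occur twice and cancel.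
\<close>

lemma lauricella_C_eq:
  "lauricella_C \<psi> (\<lambda>x. inverse (A x) * (\<Prod>i\<in>UNIV. inverse (\<Gamma> i x))) (\<lambda>x. inverse (B x))
      (\<lambda>i x. inverse (\<Gamma> i x)) lam *
    (gauss_sum \<psi> (\<lambda>x. inverse (A x) * (\<Prod>i\<in>UNIV. inverse (\<Gamma> i x))) *
     gauss_sum \<psi> (\<lambda>x. inverse (B x)) * (\<Prod>i\<in>UNIV. gauss_sum \<psi> (\<Gamma> i))) =
   1 / (1 - of_nat CARD('k)) ^ CARD('n) *
    (\<Sum>\<nu>\<in>tuples. lauricella_coeff \<nu> *
      (gauss_sum \<psi> (\<lambda>x. inverse (A x) * (\<Prod>i\<in>UNIV. inverse (\<Gamma> i x)) * (\<Prod>i\<in>UNIV. \<nu> i x)) *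
       gauss_sum \<psi> (\<lambda>x. inverse (B x) * (\<Prod>i\<in>UNIV. \<nu> i x))))"
proof -
  let ?\<alpha> = "\<lambda>x. inverse (A x) * (\<Prod>i\<in>UNIV. inverse (\<Gamma> i x))"
  let ?\<beta> = "\<lambda>x. inverse (B x)"
  let ?G = "\<Prod>i\<in>UNIV. gauss_sum \<psi> (\<Gamma> i)"
  have \<alpha>: "?\<alpha> \<in> carrier char_group"
    using A \<Gamma> by (intro char_mult_closed char_prod_closed) auto
  have nonzero: "gauss_sum \<psi> ?\<alpha> \<noteq> 0" "gauss_sum \<psi> ?\<beta> \<noteq> 0" "?G \<noteq> 0"
    using gauss_sum_nonzero[OF \<psi> nontrivial] \<alpha> B \<Gamma> by auto
  have "poch \<psi> ?\<alpha> (\<Otimes>\<^bsub>char_group\<^esub>i\<in>UNIV. \<nu> i) * poch \<psi> ?\<beta> (\<Otimes>\<^bsub>char_group\<^esub>i\<in>UNIV. \<nu> i) /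
      ((\<Prod>i\<in>UNIV. poch0 \<psi> (\<lambda>x. inverse (\<Gamma> i x)) (\<nu> i)) * (\<Prod>i\<in>UNIV. poch0 \<psi> trivial_char (\<nu> i))) *
      (\<Prod>i\<in>UNIV. \<nu> i (lam i)) * (gauss_sum \<psi> ?\<alpha> * gauss_sum \<psi> ?\<beta> * ?G) =
      lauricella_coeff \<nu> * (gauss_sum \<psi> (\<lambda>x. ?\<alpha> x * (\<Prod>i\<in>UNIV. \<nu> i x)) * gauss_sum \<psi> (\<lambda>x. ?\<beta> x * (\<Prod>i\<in>UNIV. \<nu> i x)))"
    (is "?l = ?r") if "\<nu> \<in> tuples" for \<nu>
  proof -
    have \<nu>: "\<nu> i \<in> carrier char_group" for i using that by simp
    have fin: "(\<Otimes>\<^bsub>char_group\<^esub>i\<in>UNIV. \<nu> i) = (\<lambda>x. \<Prod>i\<in>UNIV. \<nu> i x)"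
      using \<nu> by (intro finprod_char_group) auto
    have factor: "poch0 \<psi> (\<lambda>x. inverse (\<Gamma> i x)) (\<nu> i) * poch0 \<psi> trivial_char (\<nu> i) =
        gauss_sum \<psi> (\<Gamma> i) / (gauss_sum \<psi> (\<lambda>x. inverse (\<nu> i x)) * gauss_sum \<psi> (\<lambda>x. \<Gamma> i x * inverse (\<nu> i x)))" for i
    proof -
      have "poch0 \<psi> (\<lambda>x. inverse (\<Gamma> i x)) (\<nu> i) * poch0 \<psi> trivial_char (\<nu> i) =
          (\<nu> i (- 1) * \<nu> i (- 1)) *
          (gauss_sum \<psi> (\<Gamma> i) / (gauss_sum \<psi> (\<lambda>x. inverse (\<nu> i x)) * gauss_sum \<psi> (\<lambda>x. \<Gamma> i x * inverse (\<nu> i x))))"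
        using poch0_eq[OF \<psi> nontrivial char_inverse_closed[OF \<Gamma>] \<nu>, of i i]
          poch0_trivial_char[OF \<psi> nontrivial \<nu>, of i]
        by (simp add: mult_ac)
      then show ?thesis by (simp only: char_minus_1_squared[OF \<nu>] mult_1_left)
    qed
    have lauricella_coeff: "lauricella_coeff \<nu> = (\<Prod>i\<in>UNIV. \<nu> i (lam i)) * ?G /
        ((\<Prod>i\<in>UNIV. poch0 \<psi> (\<lambda>x. inverse (\<Gamma> i x)) (\<nu> i)) * (\<Prod>i\<in>UNIV. poch0 \<psi> trivial_char (\<nu> i)))"
      using nonzero(3)
      by (simp add: lauricella_coeff_def prod.distrib prod_dividef factor flip: prod.distrib) (simp add: prod.distrib)
    show ?thesis
      unfolding lauricella_coeff poch_def mult_char_group fin using nonzero by (simp add: field_simps)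
  qed
  then show ?thesis
    unfolding lauricella_C_def mult.assoc[of "1 / _"] sum_distrib_right
    by (intro arg_cong[where f = "(*) _"] sum.cong[OF refl]) simp
qed

text \<open>
  The Jacobi sum is a quotient of Gauss sums. Reflection moves the Gauss sum of \<open>A\<close> and the modified
  one of the product character, which stands in the denominator, to the conjugate characters.
\<close>

lemma jacobi_sum_times_gauss_sum:
  "jacobi_sum (case_option A \<Gamma>) * gauss_sum \<psi> (\<lambda>x. inverse (A x)) =
    (\<Prod>i\<in>UNIV. \<Gamma> i (- 1)) * (\<Prod>i\<in>UNIV. gauss_sum \<psi> (\<Gamma> i)) *
    gauss_sum \<psi> (\<lambda>x. inverse (A x) * (\<Prod>i\<in>UNIV. inverse (\<Gamma> i x)))"
proof -
  let ?J = "jacobi_sum (case_option A \<Gamma>)"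
  let ?\<alpha> = "\<lambda>x. inverse (A x) * (\<Prod>i\<in>UNIV. inverse (\<Gamma> i x))"
  let ?\<gamma> = "\<lambda>x. A x * (\<Prod>i\<in>UNIV. \<Gamma> i x)"
  let ?e = "\<Prod>i\<in>UNIV. \<Gamma> i (- 1)"
  let ?q = "of_nat CARD('k) :: qbar"
  have "\<And>i. case_option A \<Gamma> i \<in> carrier char_group" "case_option A \<Gamma> None \<noteq> trivial_char"
    using A \<Gamma> by (auto split: option.split)
  from prod_gauss_sum[OF \<psi> nontrivial, of "case_option A \<Gamma>" None, OF this]
  have J: "gauss_sum \<psi> A * (\<Prod>i\<in>UNIV. gauss_sum \<psi> (\<Gamma> i)) = ?J * gauss_sum0 \<psi> ?\<gamma>"
    by (simp add: prod_option)
  have "?\<gamma> \<in> carrier char_group"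
    using A \<Gamma> by (intro char_mult_closed char_prod_closed) auto
  from gauss_sum0_mult_gauss_sum_inverse[OF \<psi> nontrivial this]
  have \<gamma>: "gauss_sum0 \<psi> ?\<gamma> * gauss_sum \<psi> ?\<alpha> = A (- 1) * ?e * ?q"
    by (simp add: prod_inversef[symmetric] o_def)
  have e: "?e * ?e = 1"
    using char_minus_1_squared[OF \<Gamma>] by (simp flip: prod.distrib)
  have "(A (- 1) * ?q) * (?e * (?J * gauss_sum \<psi> (\<lambda>x. inverse (A x)))) =
      (?J * gauss_sum0 \<psi> ?\<gamma>) * gauss_sum \<psi> ?\<alpha> * gauss_sum \<psi> (\<lambda>x. inverse (A x))"
    using \<gamma> by (simp add: mult_ac)
  also have "\<dots> = (A (- 1) * ?q) * ((\<Prod>i\<in>UNIV. gauss_sum \<psi> (\<Gamma> i)) * gauss_sum \<psi> ?\<alpha>)"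
    unfolding J[symmetric] using gauss_sum_inverse[OF \<psi> nontrivial A] by (simp add: mult_ac)
  finally have "?e * (?J * gauss_sum \<psi> (\<lambda>x. inverse (A x))) = (\<Prod>i\<in>UNIV. gauss_sum \<psi> (\<Gamma> i)) * gauss_sum \<psi> ?\<alpha>"
    using A by simp
  then have "(?e * ?e) * (?J * gauss_sum \<psi> (\<lambda>x. inverse (A x))) =
      ?e * ((\<Prod>i\<in>UNIV. gauss_sum \<psi> (\<Gamma> i)) * gauss_sum \<psi> ?\<alpha>)"
    by (simp only: mult.assoc)
  then show ?thesis unfolding e by (simp only: mult_1_left mult.assoc)
qed

text \<open>
  Both sides, multiplied by the Gauss sums of \<open>A\<close> and \<open>B\<close> conjugate, have the same expansion over
  tuples of characters. These Gauss sums do not vanish.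
\<close>

lemma sum_eq_jacobi_sum_lauricella_C:
  "(\<Sum>x | \<forall>i. x i \<noteq> 0. (\<Prod>i\<in>UNIV. \<Gamma> i (x i)) * A (1 - (\<Sum>i\<in>UNIV. x i)) *
        B (1 - (\<Sum>i\<in>UNIV. lam i / x i))) =
    (- 1) ^ CARD('n) * jacobi_sum (case_option A \<Gamma>) *
    lauricella_C \<psi> (\<lambda>x. inverse (A x) * (\<Prod>i\<in>UNIV. inverse (\<Gamma> i x))) (\<lambda>x. inverse (B x))
      (\<lambda>i x. inverse (\<Gamma> i x)) lam"
  (is "?S = (- 1) ^ CARD('n) * ?J * ?F")
proof -
  let ?gA = "gauss_sum \<psi> (\<lambda>x. inverse (A x))"
  let ?gB = "gauss_sum \<psi> (\<lambda>x. inverse (B x))"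
  let ?g\<alpha> = "gauss_sum \<psi> (\<lambda>x. inverse (A x) * (\<Prod>i\<in>UNIV. inverse (\<Gamma> i x)))"
  let ?G = "\<Prod>i\<in>UNIV. gauss_sum \<psi> (\<Gamma> i)"
  let ?e = "\<Prod>i\<in>UNIV. \<Gamma> i (- 1)"
  have "?S * (?gA * ?gB) = (- 1) ^ CARD('n) * ?e * (?F * (?g\<alpha> * ?gB * ?G))"
    unfolding sum_times_gauss_sums_expansion lauricella_C_eq by simp
  also have "\<dots> = (- 1) ^ CARD('n) * ?F * ?gB * (?e * ?G * ?g\<alpha>)" by (simp only: mult_ac)
  also have "\<dots> = (- 1) ^ CARD('n) * ?J * ?F * (?gA * ?gB)"
    unfolding jacobi_sum_times_gauss_sum[symmetric] by (simp only: mult_ac)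
  finally show ?thesis
    using gauss_sum_nonzero[OF \<psi> nontrivial] A B by simp
qed

end

end

section \<open>Counting points\<close>

text \<open>
  Over a rational point of the base with \<open>w \<noteq> 0\<close>, a point of the fibre satisfies
  \<open>y ^ q = w ^ ((q - 1) / d) * y\<close>, so that all \<open>d\<close> of them are counted for the same \<open>\<xi>\<close>; the point \<open>y = 0\<close>
  over \<open>w = 0\<close> is counted for every \<open>\<xi>\<close>.
\<close>

lemma twisted_fibre_count:
  fixes w :: "'k :: {finite, field}" and h :: "'k \<Rightarrow> qbar"
  assumes d: "d dvd CARD('k) - 1" and d0: "d > 0"
  shows "(\<Sum>\<xi>\<in>unity_roots d. h \<xi> *
      of_nat (card {y :: 'k alg_closure. y ^ d = to_ac w \<and> y ^ CARD('k) = to_ac \<xi> * y})) =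
    (if w = 0 then \<Sum>\<xi>\<in>unity_roots d. h \<xi> else of_nat d * h (w ^ ((CARD('k) - 1) div d)))"
proof (cases "w = 0")
  case True
  have "{y :: 'k alg_closure. y ^ d = to_ac w \<and> y ^ CARD('k) = to_ac \<xi> * y} = {0}" for \<xi> :: 'k
    using True d0 by auto
  then show ?thesis using True by simp
next
  case False
  let ?u = "w ^ ((CARD('k) - 1) div d)"
  have e: "CARD('k) = Suc (d * ((CARD('k) - 1) div d))"
    using d card_field_gt_1[where 'k = 'k] by simp
  have u: "?u \<in> unity_roots d"
    using d power_card_minus_1[OF False] by (simp add: unity_roots_def flip: power_mult)
  have "{y :: 'k alg_closure. y ^ d = to_ac w \<and> y ^ CARD('k) = to_ac \<xi> * y} =
      (if \<xi> = ?u then {y. y ^ d = to_ac w} else {})" for \<xi>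
  proof -
    have "y ^ CARD('k) = to_ac \<xi> * y \<longleftrightarrow> \<xi> = ?u" if "y ^ d = to_ac w" for y
    proof -
      have "y ^ CARD('k) = to_ac ?u * y"
        by (subst e) (simp add: power_mult that)
      moreover have "y \<noteq> 0" using that False d0 by (auto simp: power_0_left)
      ultimately show ?thesis by (auto simp del: to_ac_power)
    qed
    then show ?thesis by auto
  qed
  moreover have "card {y :: 'k alg_closure. y ^ d = to_ac w} = d"
    using False of_nat_dvd_card_minus_1[OF d]
    by (intro card_nth_roots_alg_closed) (simp_all flip: to_ac_of_nat)
  ultimately have "(\<Sum>\<xi>\<in>unity_roots d. h \<xi> *
      of_nat (card {y :: 'k alg_closure. y ^ d = to_ac w \<and> y ^ CARD('k) = to_ac \<xi> * y})) =
      (\<Sum>\<xi>\<in>unity_roots d. if \<xi> = ?u then of_nat d * h \<xi> else 0)"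
    by (intro sum.cong) auto
  then show ?thesis using False u by (simp add: sum.delta)
qed

text \<open>
  Since \<open>\<mu>\<^sub>d\<close> acts on \<open>y\<close> only, a point counted for any \<open>\<xi>\<close> lies over a rational point of the base.
\<close>

lemma twisted_count_cyclic_cover:
  fixes f :: "('n :: finite \<Rightarrow> 'k :: {finite, field}) \<Rightarrow> 'k" and h :: "'k \<Rightarrow> qbar"
  assumes d: "d dvd CARD('k) - 1" and d0: "d > 0"
    and f: "\<And>x. F (\<lambda>i. to_ac (x i)) = to_ac (f x)"
  shows "twisted_count frobenius (unity_roots d) scale_y 1 {(x, y). y ^ d = F x} h =
    (\<Sum>x\<in>UNIV. if f x = 0 then (\<Sum>\<xi>\<in>unity_roots d. h \<xi>) / of_nat d
      else h (f x ^ ((CARD('k) - 1) div d)))"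
proof -
  let ?Y = "\<lambda>\<xi> w. {y :: 'k alg_closure. y ^ d = to_ac w \<and> y ^ CARD('k) = to_ac \<xi> * y}"
  have fin: "finite (?Y \<xi> w)" for \<xi> w
  proof (rule finite_subset)
    let ?p = "Polynomial.monom 1 d + [:- to_ac w:] :: 'k alg_closure poly"
    have "Polynomial.degree ?p = d"
      using d0 by (subst degree_add_eq_left) (auto simp: Polynomial.degree_monom_eq)
    then have "?p \<noteq> 0" using d0 by auto
    then show "finite {y. poly ?p y = 0}" by (rule poly_roots_finite)
    show "?Y \<xi> w \<subseteq> {y. poly ?p y = 0}" by (auto simp: poly_monom)
  qed
  have "card {P \<in> {(x, y). y ^ d = F x}. (frobenius ^^ 1) P = scale_y \<xi> P} =
      (\<Sum>x\<in>UNIV. card (?Y \<xi> (f x)))" for \<xi> :: 'k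
  proof -
    let ?e = "\<lambda>(x :: 'n \<Rightarrow> 'k, y :: 'k alg_closure). (\<lambda>i. to_ac (x i), y)"
    have "{P \<in> {(x, y). y ^ d = F x}. (frobenius ^^ 1) P = scale_y \<xi> P} =
        ?e ` (SIGMA x:UNIV. ?Y \<xi> (f x))"
    proof (intro equalityI subsetI)
      fix P assume P: "P \<in> {P \<in> {(x, y). y ^ d = F x}. (frobenius ^^ 1) P = scale_y \<xi> P}"
      obtain x y where xy: "P = (x, y)" by (cases P)
      from P have "x i ^ CARD('k) = x i" for i
        by (auto simp: xy frobenius_def scale_y_def fun_eq_iff)
      then have "\<forall>i. \<exists>z. x i = to_ac z" using frobenius_fixed_iff by blast
      then obtain z where "\<forall>i. x i = to_ac (z i)" using choice by metis
      then have "x = (\<lambda>i. to_ac (z i))" by auto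
      then have "P = ?e (z, y)" "(z, y) \<in> (SIGMA x:UNIV. ?Y \<xi> (f x))"
        using P by (auto simp: xy frobenius_def scale_y_def f)
      then show "P \<in> ?e ` (SIGMA x:UNIV. ?Y \<xi> (f x))" by blast
    next
      fix P assume "P \<in> ?e ` (SIGMA x:UNIV. ?Y \<xi> (f x))"
      then show "P \<in> {P \<in> {(x, y). y ^ d = F x}. (frobenius ^^ 1) P = scale_y \<xi> P}"
        by (auto simp: frobenius_def scale_y_def f power_card simp flip: to_ac_power)
    qed
    moreover have "inj_on ?e (SIGMA x:UNIV. ?Y \<xi> (f x))"
      by (auto simp: inj_on_def fun_eq_iff)
    ultimately show ?thesis using fin by (simp add: card_image)
  qed
  then have "twisted_count frobenius (unity_roots d) scale_y 1 {(x, y). y ^ d = F x} h =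
      1 / of_nat d * (\<Sum>\<xi>\<in>unity_roots d. \<Sum>x\<in>UNIV. h \<xi> * of_nat (card (?Y \<xi> (f x))))"
    by (simp add: twisted_count_def card_unity_roots[OF d] sum_distrib_left)
  also have "\<dots> = (\<Sum>x\<in>UNIV. 1 / of_nat d *
      (if f x = 0 then \<Sum>\<xi>\<in>unity_roots d. h \<xi> else of_nat d * h (f x ^ ((CARD('k) - 1) div d))))"
    by (subst sum.swap) (simp only: twisted_fibre_count[OF d d0] sum_distrib_left)
  also have "\<dots> = (\<Sum>x\<in>UNIV. if f x = 0 then (\<Sum>\<xi>\<in>unity_roots d. h \<xi>) / of_nat d
      else h (f x ^ ((CARD('k) - 1) div d)))"
    using d0 by (intro sum.cong) auto
  finally show ?thesis .
qed

lemma phi_d_closed: "\<phi> \<in> carrier char_group \<Longrightarrow> phi_d \<phi> d \<in> carrier char_group"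
  by (simp add: phi_d_def)

lemma phi_d_int_pow:
  fixes \<phi> :: "'k :: {finite, field} \<Rightarrow> qbar"
  assumes "\<phi> \<in> carrier char_group"
  shows "phi_d \<phi> d [^]\<^bsub>char_group\<^esub> (m :: int) = \<phi> [^]\<^bsub>char_group\<^esub> (int ((CARD('k) - 1) div d) * m)"
  using char_group.int_pow_pow[OF assms, of "int ((CARD('k) - 1) div d)" m]
  by (simp add: phi_d_def int_pow_int mult.commute)

text \<open>
  This is how the character of \<open>\<mu>\<^sub>d\<close>, evaluated at the Frobenius twist \<open>w ^ ((q - 1) / d)\<close> of a fibre,
  becomes a character of the whole field evaluated at \<open>w\<close>.
\<close>

lemma phi_d_int_pow_apply:
  fixes \<phi> :: "'k :: {finite, field} \<Rightarrow> qbar"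
  assumes "\<phi> \<in> carrier char_group" "d dvd CARD('k) - 1" "w \<noteq> 0"
  shows "(phi_d \<phi> d [^]\<^bsub>char_group\<^esub> (m :: int)) w = chi_pow \<phi> d m (w ^ ((CARD('k) - 1) div d))"
proof -
  have "w ^ ((CARD('k) - 1) div d) \<in> unity_roots d"
    using assms(2) power_card_minus_1[OF assms(3)] by (simp add: unity_roots_def flip: power_mult)
  then show ?thesis
    using assms by (simp add: phi_d_int_pow int_pow_char_group chi_pow_def char_power power_int_mult)
qed

lemma phi_d_int_pow_eq_trivial_iff:
  fixes \<phi> :: "'k :: {finite, field} \<Rightarrow> qbar"
  assumes \<phi>: "\<phi> \<in> carrier char_group" "generate char_group {\<phi>} = carrier char_group"
    and d: "d dvd CARD('k) - 1"
  shows "phi_d \<phi> d [^]\<^bsub>char_group\<^esub> (m :: int) = trivial_char \<longleftrightarrow> int d dvd m"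
proof -
  obtain e where e: "CARD('k) - 1 = d * e" using d by blast
  then have "d > 0" "e > 0" using card_field_gt_1[where 'k = 'k] by (auto intro!: Nat.gr0I)
  then have "int (CARD('k) - 1) dvd int ((CARD('k) - 1) div d) * m \<longleftrightarrow> int d dvd m"
    unfolding e by (simp add: mult.commute)
  then show ?thesis
    by (simp only: phi_d_int_pow[OF \<phi>(1)] generator_int_pow_eq_one_iff[OF \<phi>])
qed

lemma chi_pow_eq_1:
  assumes "\<phi> \<in> carrier char_group" "int d dvd m" "\<xi> \<in> unity_roots d"
  shows "chi_pow \<phi> d m \<xi> = 1"
proof -
  obtain k where k: "m = int d * k" using assms(2) by blast
  have "\<phi> \<xi> ^ d = \<phi> (\<xi> ^ d)" by (simp only: char_power[OF assms(1)])
  also have "\<dots> = 1" using assms by (simp add: unity_roots_def)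
  finally show ?thesis using assms(3) by (simp add: chi_pow_def k power_int_mult)
qed

text \<open>
  The restriction to \<open>\<mu>\<^sub>d\<close> is nontrivial: the elements \<open>w ^ ((q - 1) / d)\<close> lie in \<open>\<mu>\<^sub>d\<close>, and the values
  there are those of a nontrivial character at \<open>w\<close>.
\<close>

lemma sum_chi_pow:
  fixes \<phi> :: "'k :: {finite, field} \<Rightarrow> qbar"
  assumes \<phi>: "\<phi> \<in> carrier char_group" "generate char_group {\<phi>} = carrier char_group"
    and d: "d dvd CARD('k) - 1" and m: "\<not> int d dvd m"
  shows "(\<Sum>\<xi>\<in>unity_roots d. chi_pow \<phi> d m \<xi>) = 0"
proof -
  have "phi_d \<phi> d [^]\<^bsub>char_group\<^esub> m \<noteq> trivial_char"
    using m phi_d_int_pow_eq_trivial_iff[OF \<phi> d] by blast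
  then obtain w where w: "w \<noteq> 0" "(phi_d \<phi> d [^]\<^bsub>char_group\<^esub> m) w \<noteq> 1"
    using nontrivial_charE char_group.int_pow_closed[OF phi_d_closed[OF \<phi>(1)]] by metis
  define u where "u = w ^ ((CARD('k) - 1) div d)"
  have u: "u \<in> unity_roots d" "u \<noteq> 0"
    using d power_card_minus_1[OF w(1)] w(1) by (simp_all add: u_def unity_roots_def flip: power_mult)
  have u1: "chi_pow \<phi> d m u \<noteq> 1"
    using w phi_d_int_pow_apply[OF \<phi>(1) d w(1)] by (simp add: u_def)
  have "(\<Sum>\<xi>\<in>unity_roots d. chi_pow \<phi> d m \<xi>) = (\<Sum>\<xi>\<in>unity_roots d. chi_pow \<phi> d m u * chi_pow \<phi> d m \<xi>)"
    by (rule sum.reindex_bij_witness[of _ "\<lambda>\<xi>. u * \<xi>" "\<lambda>\<xi>. \<xi> / u"])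
      (use u in \<open>auto simp: unity_roots_def chi_pow_def power_mult_distrib power_divide char_mult[OF \<phi>(1), symmetric] power_int_mult_distrib[symmetric]\<close>)
  then show ?thesis using u1 by (simp add: sum_distrib_left[symmetric])
qed

theorem theorem4p11:
  fixes \<psi> \<phi> :: "'k :: {finite, field} \<Rightarrow> qbar"
    and d a b :: nat and c :: "'n :: finite \<Rightarrow> nat"
    and lam :: "'n \<Rightarrow> 'k" and m :: int
  assumes "add_character \<psi>" and "\<exists>x. \<psi> x \<noteq> 1"
    and "\<phi> \<in> carrier char_group" and "generate char_group {\<phi>} = carrier char_group"
    and "d > 0" and "a > 0" and "b > 0" and "\<And>i. c i > 0"
    and "d dvd CARD('k) - 1"
    and "\<And>i. lam i \<noteq> 0"
    and "gcd d a = 1" and "gcd d b = 1"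
  shows "twisted_count frobenius (unity_roots d) scale_y 1
           (hypersurface_C d a b c lam) (chi_pow \<phi> d m) =
         (if int d dvd m then of_nat CARD('k) ^ CARD('n)
          else (- 1) ^ CARD('n) *
            jacobi_sum (case_option (phi_d \<phi> d [^]\<^bsub>char_group\<^esub> (m * int a))
                                    (\<lambda>i. phi_d \<phi> d [^]\<^bsub>char_group\<^esub> (m * int (b + c i)))) *
            lauricella_C \<psi>
              ((inv\<^bsub>char_group\<^esub> phi_d \<phi> d) [^]\<^bsub>char_group\<^esub> (m * int (a + CARD('n) * b + (\<Sum>i\<in>UNIV. c i))))
              ((inv\<^bsub>char_group\<^esub> phi_d \<phi> d) [^]\<^bsub>char_group\<^esub> (m * int b))
              (\<lambda>i. (inv\<^bsub>char_group\<^esub> phi_d \<phi> d) [^]\<^bsub>char_group\<^esub> (m * int (b + c i)))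
              lam)"
proof -
  note \<phi> = assms(3,4) and d = \<open>d dvd CARD('k) - 1\<close>
  let ?h = "chi_pow \<phi> d m"
  define f where "f = (\<lambda>x :: 'n \<Rightarrow> 'k. (\<Prod>i\<in>UNIV. x i ^ c i) * (1 - (\<Sum>i\<in>UNIV. x i)) ^ a *
        ((\<Prod>i\<in>UNIV. x i) - (\<Sum>i\<in>UNIV. lam i * (\<Prod>j\<in>UNIV - {i}. x j))) ^ b)"
  have count: "twisted_count frobenius (unity_roots d) scale_y 1 (hypersurface_C d a b c lam) ?h =
      (\<Sum>x\<in>UNIV. if f x = 0 then (\<Sum>\<xi>\<in>unity_roots d. ?h \<xi>) / of_nat d
        else ?h (f x ^ ((CARD('k) - 1) div d)))"
    unfolding hypersurface_C_def
    by (rule twisted_count_cyclic_cover[OF d \<open>d > 0\<close>]) (simp add: f_def to_ac_sum to_ac_prod)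
  show ?thesis
  proof (cases "int d dvd m")
    case True
    \<comment> \<open>The character of \<open>\<mu>\<^sub>d\<close> is trivial, so each rational point of the base contributes \<open>1\<close>.\<close>
    have "f x ^ ((CARD('k) - 1) div d) \<in> unity_roots d" if "f x \<noteq> 0" for x
      using d power_card_minus_1[OF that] by (simp add: unity_roots_def flip: power_mult)
    then have "(\<Sum>x\<in>UNIV. if f x = 0 then (\<Sum>\<xi>\<in>unity_roots d. ?h \<xi>) / of_nat d
        else ?h (f x ^ ((CARD('k) - 1) div d))) = (\<Sum>x\<in>(UNIV :: ('n \<Rightarrow> 'k) set). 1)"
      using \<open>d > 0\<close> by (intro sum.cong) (simp_all add: chi_pow_eq_1[OF \<phi>(1) True] card_unity_roots[OF d])
    then show ?thesis using True count by (simp add: card_fun)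
  next
    case False
    define \<theta> where "\<theta> = phi_d \<phi> d [^]\<^bsub>char_group\<^esub> m"
    note phi_d = phi_d_closed[OF \<phi>(1), of d]
    have \<theta>: "\<theta> \<in> carrier char_group" unfolding \<theta>_def using phi_d by simp
    have \<theta>_power: "phi_d \<phi> d [^]\<^bsub>char_group\<^esub> (m * int k) = (\<lambda>x. \<theta> x ^ k)" if "k > 0" for k
    proof -
      have "phi_d \<phi> d [^]\<^bsub>char_group\<^esub> (m * int k) = \<theta> [^]\<^bsub>char_group\<^esub> k"
        using char_group.int_pow_pow[OF phi_d, of m "int k"]
        by (simp add: \<theta>_def int_pow_int mult.commute)
      then show ?thesis using that \<theta> by (auto simp: nat_pow_char_group)
    qed
    have inverse_power: "(inv\<^bsub>char_group\<^esub> phi_d \<phi> d) [^]\<^bsub>char_group\<^esub> (m * int k) = (\<lambda>x. inverse (\<theta> x ^ k))"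
      if "k > 0" for k
      using \<theta>_power[OF that] char_power_closed[OF \<theta> that]
      by (simp add: char_group.int_pow_inv[OF phi_d] inv_char_group)
    \<comment> \<open>The coprimality of \<open>d\<close> with \<open>a\<close> and \<open>b\<close> enters here, to keep \<open>\<theta>\<^sup>a\<close> and \<open>\<theta>\<^sup>b\<close> nontrivial.\<close>
    have nontrivial: "(\<lambda>x. \<theta> x ^ k) \<noteq> trivial_char" if "k > 0" "gcd d k = 1" for k
    proof -
      have "\<not> int d dvd m * int k"
        using False that(2) by (simp add: coprime_dvd_mult_left_iff coprime_iff_gcd_eq_1)
      then show ?thesis
        using phi_d_int_pow_eq_trivial_iff[OF \<phi> d] \<theta>_power[OF that(1)] by metis
    qed
    have \<theta>_f: "\<theta> (f x) = (\<Prod>i\<in>UNIV. \<theta> (x i) ^ (b + c i)) * \<theta> (1 - (\<Sum>i\<in>UNIV. x i)) ^ a *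
        \<theta> (1 - (\<Sum>i\<in>UNIV. lam i / x i)) ^ b" if x: "\<forall>i. x i \<noteq> 0" for x
    proof -
      have "lam i * (\<Prod>j\<in>UNIV - {i}. x j) = (\<Prod>j\<in>UNIV. x j) * (lam i / x i)" for i
        using x by (subst prod.remove[of UNIV i]) auto
      then have "(\<Prod>i\<in>UNIV. x i) - (\<Sum>i\<in>UNIV. lam i * (\<Prod>j\<in>UNIV - {i}. x j)) =
          (\<Prod>i\<in>UNIV. x i) * (1 - (\<Sum>i\<in>UNIV. lam i / x i))"
        by (simp only: right_diff_distrib sum_distrib_left mult_1_right)
      then have "f x = (\<Prod>i\<in>UNIV. x i ^ c i) * (1 - (\<Sum>i\<in>UNIV. x i)) ^ a *
          ((\<Prod>i\<in>UNIV. x i) * (1 - (\<Sum>i\<in>UNIV. lam i / x i))) ^ b"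
        by (simp only: f_def)
      then show ?thesis
        by (simp add: char_mult[OF \<theta>] char_power[OF \<theta>] char_prod[OF \<theta>] power_mult_distrib
            power_add prod.distrib prod_power_distrib mult_ac)
    qed
    have "(\<Sum>x\<in>UNIV. if f x = 0 then (\<Sum>\<xi>\<in>unity_roots d. ?h \<xi>) / of_nat d
        else ?h (f x ^ ((CARD('k) - 1) div d))) = (\<Sum>x\<in>UNIV. \<theta> (f x))"
      using \<theta> by (intro sum.cong) (auto simp: \<theta>_def sum_chi_pow[OF \<phi> d False] phi_d_int_pow_apply[OF \<phi>(1) d])
    \<comment> \<open>A vanishing coordinate makes \<open>f x = 0\<close>, because the exponents \<open>c i\<close> are positive.\<close>
    also have "\<dots> = (\<Sum>x | \<forall>i. x i \<noteq> 0. \<theta> (f x))"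
      using \<theta> \<open>\<And>i. c i > 0\<close> by (intro sum.mono_neutral_right) (auto simp: f_def)
    also have "\<dots> = (\<Sum>x | \<forall>i. x i \<noteq> 0. (\<Prod>i\<in>UNIV. \<theta> (x i) ^ (b + c i)) * \<theta> (1 - (\<Sum>i\<in>UNIV. x i)) ^ a *
        \<theta> (1 - (\<Sum>i\<in>UNIV. lam i / x i)) ^ b)"
      by (intro sum.cong) (auto simp: \<theta>_f)
    also have "\<dots> = (- 1) ^ CARD('n) *
        jacobi_sum (case_option (\<lambda>x. \<theta> x ^ a) (\<lambda>i x. \<theta> x ^ (b + c i))) *
        lauricella_C \<psi> (\<lambda>x. inverse (\<theta> x ^ a) * (\<Prod>i\<in>UNIV. inverse (\<theta> x ^ (b + c i))))
          (\<lambda>x. inverse (\<theta> x ^ b)) (\<lambda>i x. inverse (\<theta> x ^ (b + c i))) lam"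
      using assms
      by (intro sum_eq_jacobi_sum_lauricella_C char_power_closed[OF \<theta>] nontrivial) auto
    also have "(\<lambda>x. inverse (\<theta> x ^ a) * (\<Prod>i\<in>UNIV. inverse (\<theta> x ^ (b + c i)))) =
        (\<lambda>x. inverse (\<theta> x ^ (a + CARD('n) * b + (\<Sum>i\<in>UNIV. c i))))"
    proof
      fix x
      have "(\<Prod>i\<in>UNIV. inverse (\<theta> x ^ (b + c i))) = inverse (\<theta> x ^ (\<Sum>i\<in>UNIV. b + c i))"
        by (simp only: power_sum prod_inversef[unfolded o_def])
      then show "inverse (\<theta> x ^ a) * (\<Prod>i\<in>UNIV. inverse (\<theta> x ^ (b + c i))) =
          inverse (\<theta> x ^ (a + CARD('n) * b + (\<Sum>i\<in>UNIV. c i)))"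
        by (simp add: sum.distrib power_add)
    qed
    finally have "(\<Sum>x\<in>UNIV. if f x = 0 then (\<Sum>\<xi>\<in>unity_roots d. ?h \<xi>) / of_nat d
        else ?h (f x ^ ((CARD('k) - 1) div d))) = (- 1) ^ CARD('n) *
        jacobi_sum (case_option (\<lambda>x. \<theta> x ^ a) (\<lambda>i x. \<theta> x ^ (b + c i))) *
        lauricella_C \<psi> (\<lambda>x. inverse (\<theta> x ^ (a + CARD('n) * b + (\<Sum>i\<in>UNIV. c i))))
          (\<lambda>x. inverse (\<theta> x ^ b)) (\<lambda>i x. inverse (\<theta> x ^ (b + c i))) lam" .
    moreover have "b + c i > 0" "a + CARD('n) * b + (\<Sum>i\<in>UNIV. c i) > 0" for i
      using \<open>a > 0\<close> \<open>b > 0\<close> by simp_all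
    ultimately show ?thesis
      by (simp only: count False if_False \<theta>_power inverse_power \<open>a > 0\<close> \<open>b > 0\<close>)
  qed
qed

end
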